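(* Let $G$ be a group that is hyperbolic relative to a finite collection of subgroups $\mathbb{P}$. Let $Q$ and $R$ be relatively quasiconvex subgroups of $G$ with compatible parabolic subgroups, and suppose that $Q \cap R$ is a separable subgroup of $G$. Then $Q$ and $R$ can be virtually amalgamated in $G$.
   Context: Relative hyperbolicity: a group $G$ is hyperbolic relative to a finite collection of subgroups $\mathbb{P}$ if $G$ acts properly discontinuously and by isometries on a proper geodesic $\delta$-hyperbolic space $X$ that has a $G$-equivariant collection of pairwise disjoint horoballs whose union is an open set $U$, such that $G$ acts cocompactly on $X - U$ and $\mathbb{P}$ is a set of representatives of the conjugacy classes of maximal parabolic subgroups of $G$. The maximal parabolic subgroups are the $G$-stabilizers of the horoballs, that is, the conjugates of members of $\mathbb{P}$. Fix such an $X$ and $U$, and a basepoint $x_0 \in X - U$; each $g \in G$ is identified with the point $g x_0 \in X$. Relative quasiconvexity: a subgroup $Q$ of $G$ is relatively quasiconvex if there is $\mu \geq 0$ such that for any geodesic $c$ in $X$ with endpoints in $Q$ (i.e. in $Qx_0$), $c \cap (X - U)$ is contained in the $\mu$-neighborhood of $Q$ (i.e. of $Q x_0$) in $X$. Compatible parabolic subgroups: two subgroups $A$ and $B$ of $G$ have compatible parabolic subgroups if for every maximal parabolic subgroup $P$ of $G$, either $A \cap P \leq B \cap P$ or $B \cap P \leq A \cap P$. Separable: a subgroup of $G$ is separable if it is an intersection of finite index subgroups of $G$. Virtual amalgamation: two subgroups $Q$ and $R$ of a group $G$ can be virtually amalgamated if there are finite index subgroups $Q' \leq Q$ and $R' \leq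 R$ such that the natural map $Q' \ast_{Q' \cap R'} R' \to G$ from the amalgamated free product is injective. *)

theory Defs
  imports "HOL-Analysis.Analysis" "HOL-Algebra.Group_Action"
begin

section \<open>Proper hyperbolic geodesic spaces\<close>

definition geodesic_path :: "'x::metric_space \<Rightarrow> 'x \<Rightarrow> (real \<Rightarrow> 'x) \<Rightarrow> bool" where
  "geodesic_path x y c \<longleftrightarrow> c 0 = x \<and> c (dist x y) = y \<and>
     (\<forall>s\<in>{0..dist x y}. \<forall>t\<in>{0..dist x y}. dist (c s) (c t) = \<bar>s - t\<bar>)"

definition geodesic_segment :: "'x::metric_space \<Rightarrow> 'x \<Rightarrow> 'x set \<Rightarrow> bool" where
  "geodesic_segment x y S \<longleftrightarrow> (\<exists>c. geodesic_path x y c \<and> S = c ` {0..dist x y})"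

definition proper_space :: "'x::metric_space itself \<Rightarrow> bool" where
  "proper_space _ \<longleftrightarrow> (\<forall>(x::'x) r. compact (cball x r))"

definition geodesic_space :: "'x::metric_space itself \<Rightarrow> bool" where
  "geodesic_space _ \<longleftrightarrow> (\<forall>(x::'x) y. \<exists>S. geodesic_segment x y S)"

definition hyperbolic_space :: "real \<Rightarrow> 'x::metric_space itself \<Rightarrow> bool" where
  "hyperbolic_space \<delta> _ \<longleftrightarrow>
     (\<forall>(x::'x) y z S T V. geodesic_segment x y S \<and> geodesic_segment y z T \<and> geodesic_segment x z V
        \<longrightarrow> (\<forall>p\<in>S. \<exists>q\<in>T \<union> V. dist p q \<le> \<delta>))"

section \<open>Boundary at infinity and horoballs\<close>

text \<open>Only the restriction of a ray to the non-negative reals matters.\<close>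

definition geodesic_ray :: "(real \<Rightarrow> 'x::metric_space) \<Rightarrow> bool" where
  "geodesic_ray c \<longleftrightarrow> (\<forall>s\<ge>0. \<forall>t\<ge>0. dist (c s) (c t) = \<bar>s - t\<bar>)"

definition asymptotic_rays :: "((real \<Rightarrow> 'x::metric_space) \<times> (real \<Rightarrow> 'x)) set" where
  "asymptotic_rays = {(c, c'). geodesic_ray c \<and> geodesic_ray c' \<and>
                        (\<exists>D. \<forall>t\<ge>0. dist (c t) (c' t) \<le> D)}"

definition boundary_at_infinity :: "(real \<Rightarrow> 'x::metric_space) set set" where
  "boundary_at_infinity = {c. geodesic_ray c} // asymptotic_rays"

text \<open>The point \<open>w\<close> is an \<open>r\<close>-centre of some geodesic triangle with vertices \<open>x\<close>, \<open>y\<close> and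
  the ideal point \<open>\<xi>\<close>: it lies within \<open>r\<close> of each of the three sides.\<close>

definition ideal_triangle_centre ::
    "real \<Rightarrow> 'x::metric_space \<Rightarrow> 'x \<Rightarrow> (real \<Rightarrow> 'x) set \<Rightarrow> 'x \<Rightarrow> bool" where
  "ideal_triangle_centre r x y \<xi> w \<longleftrightarrow>
     (\<exists>S a b. geodesic_segment x y S \<and> a \<in> \<xi> \<and> a 0 = x \<and> b \<in> \<xi> \<and> b 0 = y \<and>
        (\<exists>p\<in>S. dist w p \<le> r) \<and> (\<exists>t\<ge>0. dist w (a t) \<le> r) \<and> (\<exists>t\<ge>0. dist w (b t) \<le> r))"

text \<open>Horofunctions and horoballs in the coarse sense of Gromov and Bowditch.  In a hyperbolic
  space any two \<open>r\<close>-centres of a triangle are uniformly close, so that it is equivalent to ask for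
  the bound with a single \<open>r\<close> large enough for every triangle to have an \<open>r\<close>-centre; quantifying
  over all \<open>r\<close> avoids singling out such a constant.  With this sign convention, \<open>h\<close> tends to
  infinity along rays towards \<open>\<xi>\<close>.\<close>

definition horofunction :: "(real \<Rightarrow> 'x::metric_space) set \<Rightarrow> ('x \<Rightarrow> real) \<Rightarrow> bool" where
  "horofunction \<xi> h \<longleftrightarrow> (\<forall>r. \<exists>D. \<forall>x y w. ideal_triangle_centre r x y \<xi> w \<longrightarrow>
      \<bar>(h x + dist x w) - (h y + dist y w)\<bar> \<le> D)"

definition horoball :: "'x::metric_space set \<Rightarrow> bool" where
  "horoball H \<longleftrightarrow> (\<exists>\<xi>\<in>boundary_at_infinity. \<exists>h D. horofunction \<xi> h \<and>
      (\<forall>x\<in>H. h x \<ge> - D) \<and> (\<forall>x\<in>- H. h x \<le> D))"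

section \<open>Relatively hyperbolic groups\<close>

definition maximal_parabolic ::
    "('a, 'm) monoid_scheme \<Rightarrow> ('a \<Rightarrow> 'x \<Rightarrow> 'x) \<Rightarrow> 'x set set \<Rightarrow> 'a set \<Rightarrow> bool" where
  "maximal_parabolic G \<phi> \<H> P \<longleftrightarrow> (\<exists>H\<in>\<H>. P = stabilizer G (\<lambda>g. image (\<phi> g)) H)"

text \<open>The locale predicate says that \<open>G\<close> is hyperbolic relative to \<open>\<PP>\<close>, as witnessed by the action
  \<open>\<phi>\<close> on the space \<open>X\<close> formed by all points of the type \<open>'x\<close>, the collection \<open>\<H>\<close> of horoballs
  with union \<open>U\<close>, and the basepoint \<open>x0\<close>.  The individual horoballs are required to be open, and
  not only their union: otherwise, a geodesic could pass from one horoball to another without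
  meeting \<open>X - U\<close>.\<close>

locale relatively_hyperbolic = group_action G UNIV \<phi>
  for G :: "('a, 'm) monoid_scheme" (structure)
    and \<phi> :: "'a \<Rightarrow> 'x::metric_space \<Rightarrow> 'x" +
  fixes \<PP> :: "'a set set"
    and \<H> :: "'x set set"
    and x0 :: 'x
  assumes proper: "proper_space TYPE('x)"
    and geodesic: "geodesic_space TYPE('x)"
    and hyperbolic: "\<exists>\<delta>. hyperbolic_space \<delta> TYPE('x)"
    and isometric: "\<And>g x y. g \<in> carrier G \<Longrightarrow> dist (\<phi> g x) (\<phi> g y) = dist x y"
    and properly_discontinuous:
      "\<And>K. compact K \<Longrightarrow> finite {g \<in> carrier G. \<phi> g ` K \<inter> K \<noteq> {}}"
    and horoballs: "\<And>H. H \<in> \<H> \<Longrightarrow> horoball H \<and> open H"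
    and disjoint_horoballs: "pairwise disjnt \<H>"
    and equivariant: "\<And>g H. g \<in> carrier G \<Longrightarrow> H \<in> \<H> \<Longrightarrow> \<phi> g ` H \<in> \<H>"
    and cocompact: "\<exists>K. compact K \<and> - \<Union>\<H> = (\<Union>g\<in>carrier G. \<phi> g ` K)"
    and basepoint: "x0 \<notin> \<Union>\<H>"
    and finite_peripherals: "finite \<PP>"
    and peripherals_parabolic: "\<And>P. P \<in> \<PP> \<Longrightarrow> maximal_parabolic G \<phi> \<H> P"
    and parabolic_representatives:
      "\<And>P. maximal_parabolic G \<phi> \<H> P \<Longrightarrow>
         \<exists>!P0. P0 \<in> \<PP> \<and> (\<exists>g\<in>carrier G. P = (g <#\<^bsub>G\<^esub> P0) #>\<^bsub>G\<^esub> inv\<^bsub>G\<^esub> g)"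

definition relatively_quasiconvex ::
    "('a \<Rightarrow> 'x::metric_space \<Rightarrow> 'x) \<Rightarrow> 'x set set \<Rightarrow> 'x \<Rightarrow> 'a set \<Rightarrow> bool" where
  "relatively_quasiconvex \<phi> \<H> x0 Q \<longleftrightarrow>
     (\<exists>\<mu>\<ge>0. \<forall>q1\<in>Q. \<forall>q2\<in>Q. \<forall>S. geodesic_segment (\<phi> q1 x0) (\<phi> q2 x0) S \<longrightarrow>
        (\<forall>p\<in>S - \<Union>\<H>. \<exists>q\<in>Q. dist p (\<phi> q x0) \<le> \<mu>))"

definition compatible_parabolics ::
    "('a, 'm) monoid_scheme \<Rightarrow> ('a \<Rightarrow> 'x \<Rightarrow> 'x) \<Rightarrow> 'x set set \<Rightarrow> 'a set \<Rightarrow> 'a set \<Rightarrow> bool" where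
  "compatible_parabolics G \<phi> \<H> A B \<longleftrightarrow>
     (\<forall>P. maximal_parabolic G \<phi> \<H> P \<longrightarrow> A \<inter> P \<subseteq> B \<inter> P \<or> B \<inter> P \<subseteq> A \<inter> P)"

section \<open>Finite index and separability\<close>

definition finite_index_subgroup ::
    "'a set \<Rightarrow> ('a, 'm) monoid_scheme \<Rightarrow> bool" where
  "finite_index_subgroup H G \<longleftrightarrow> subgroup H G \<and> finite (rcosets\<^bsub>G\<^esub> H)"

definition separable_subgroup ::
    "'a set \<Rightarrow> ('a, 'm) monoid_scheme \<Rightarrow> bool" where
  "separable_subgroup H G \<longleftrightarrow>
     (\<exists>F. F \<noteq> {} \<and> (\<forall>K\<in>F. finite_index_subgroup K G) \<and> H = \<Inter>F)"

section \<open>Amalgamated free products\<close>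

text \<open>Words in the disjoint union of \<open>A\<close> and \<open>B\<close>, modulo the multiplication tables of \<open>A\<close> and
  \<open>B\<close> and the identification of the two images of \<open>C\<close>.\<close>

inductive amalgam_eq ::
    "('a, 'm) monoid_scheme \<Rightarrow> ('b, 'n) monoid_scheme \<Rightarrow> ('c, 'k) monoid_scheme \<Rightarrow>
     ('c \<Rightarrow> 'a) \<Rightarrow> ('c \<Rightarrow> 'b) \<Rightarrow> ('a + 'b) list \<Rightarrow> ('a + 'b) list \<Rightarrow> bool"
  for A B C i j where
  refl: "w \<in> lists (carrier A <+> carrier B) \<Longrightarrow> amalgam_eq A B C i j w w"
| sym: "amalgam_eq A B C i j u v \<Longrightarrow> amalgam_eq A B C i j v u"
| trans: "amalgam_eq A B C i j u v \<Longrightarrow> amalgam_eq A B C i j v w \<Longrightarrow> amalgam_eq A B C i j u w"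
| append: "amalgam_eq A B C i j u u' \<Longrightarrow> amalgam_eq A B C i j v v' \<Longrightarrow>
            amalgam_eq A B C i j (u @ v) (u' @ v')"
| one_left: "amalgam_eq A B C i j [Inl \<one>\<^bsub>A\<^esub>] []"
| one_right: "amalgam_eq A B C i j [Inr \<one>\<^bsub>B\<^esub>] []"
| mult_left: "a \<in> carrier A \<Longrightarrow> a' \<in> carrier A \<Longrightarrow>
            amalgam_eq A B C i j [Inl a, Inl a'] [Inl (a \<otimes>\<^bsub>A\<^esub> a')]"
| mult_right: "b \<in> carrier B \<Longrightarrow> b' \<in> carrier B \<Longrightarrow>
            amalgam_eq A B C i j [Inr b, Inr b'] [Inr (b \<otimes>\<^bsub>B\<^esub> b')]"
| amalgamate: "c \<in> carrier C \<Longrightarrow> amalgam_eq A B C i j [Inl (i c)] [Inr (j c)]"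

definition amalgam_rel where
  "amalgam_rel A B C i j = {(u, v). amalgam_eq A B C i j u v}"

definition amalgamated_product ::
    "('a, 'm) monoid_scheme \<Rightarrow> ('b, 'n) monoid_scheme \<Rightarrow> ('c, 'k) monoid_scheme \<Rightarrow>
     ('c \<Rightarrow> 'a) \<Rightarrow> ('c \<Rightarrow> 'b) \<Rightarrow> ('a + 'b) list set monoid" where
  "amalgamated_product A B C i j =
     \<lparr>carrier = lists (carrier A <+> carrier B) // amalgam_rel A B C i j,
      monoid.mult = (\<lambda>X Y. \<Union>u\<in>X. \<Union>v\<in>Y. amalgam_rel A B C i j `` {u @ v}),
      one = amalgam_rel A B C i j `` {[]}\<rparr>"

text \<open>The homomorphism out of the amalgamated product induced by homomorphisms \<open>f\<close> on \<open>A\<close> and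
  \<open>g\<close> on \<open>B\<close>.\<close>

definition word_value ::
    "('g, 'm) monoid_scheme \<Rightarrow> ('a \<Rightarrow> 'g) \<Rightarrow> ('b \<Rightarrow> 'g) \<Rightarrow> ('a + 'b) list \<Rightarrow> 'g" where
  "word_value G f g w = foldr (\<lambda>l y. case_sum f g l \<otimes>\<^bsub>G\<^esub> y) w \<one>\<^bsub>G\<^esub>"

definition amalgam_map ::
    "('g, 'm) monoid_scheme \<Rightarrow> ('a \<Rightarrow> 'g) \<Rightarrow> ('b \<Rightarrow> 'g) \<Rightarrow> ('a + 'b) list set \<Rightarrow> 'g" where
  "amalgam_map G f g X = the_elem (word_value G f g ` X)"

definition virtually_amalgamable ::
    "('a, 'm) monoid_scheme \<Rightarrow> 'a set \<Rightarrow> 'a set \<Rightarrow> bool" where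
  "virtually_amalgamable G Q R \<longleftrightarrow>
     (\<exists>Q' R'. finite_index_subgroup Q' (G\<lparr>carrier := Q\<rparr>) \<and>
              finite_index_subgroup R' (G\<lparr>carrier := R\<rparr>) \<and>
              inj_on (amalgam_map G (\<lambda>x. x) (\<lambda>x. x))
                (carrier (amalgamated_product (G\<lparr>carrier := Q'\<rparr>) (G\<lparr>carrier := R'\<rparr>)
                   (G\<lparr>carrier := Q' \<inter> R'\<rparr>) (\<lambda>x. x) (\<lambda>x. x))))"

subsection \<open>The amalgamated product is a pushout of groups\<close>

locale amalgam = A: group A + B: group B
  for A :: "('a, 'm) monoid_scheme" and B :: "('b, 'n) monoid_scheme" +
  fixes C :: "('c, 'k) monoid_scheme" and i :: "'c \<Rightarrow> 'a" and j :: "'c \<Rightarrow> 'b"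
  assumes i_hom: "i \<in> hom C A" and j_hom: "j \<in> hom C B"
begin

abbreviation "W \<equiv> lists (carrier A <+> carrier B)"
abbreviation "E \<equiv> amalgam_rel A B C i j"
abbreviation "AP \<equiv> amalgamated_product A B C i j"

lemma amalgam_eq_words: "amalgam_eq A B C i j u v \<Longrightarrow> u \<in> W \<and> v \<in> W"
  by (induction rule: amalgam_eq.induct) (use i_hom j_hom in \<open>auto simp: hom_def Pi_def\<close>)

lemma equiv_E: "equiv W E"
proof (rule equivI)
  show "E \<subseteq> W \<times> W" using amalgam_eq_words by (auto simp: amalgam_rel_def)
  show "refl_on W E" by (auto simp: refl_on_def amalgam_rel_def intro: amalgam_eq.refl)
  show "sym E" by (auto simp: sym_def amalgam_rel_def intro: amalgam_eq.sym)
  show "trans E" by (auto simp: trans_def amalgam_rel_def intro: amalgam_eq.trans)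
qed

lemma carrier_AP: "carrier AP = W // E"
  by (simp add: amalgamated_product_def)

lemma class_eqI: "amalgam_eq A B C i j u v \<Longrightarrow> E `` {u} = E `` {v}"
  by (rule equiv_class_eq[OF equiv_E]) (simp add: amalgam_rel_def)

lemma AP_cases:
  assumes "X \<in> carrier AP" obtains w where "w \<in> W" "X = E `` {w}"
  using assms by (metis carrier_AP quotientE)

lemma class_in_AP: "w \<in> W \<Longrightarrow> E `` {w} \<in> carrier AP"
  unfolding carrier_AP by (rule quotientI)

lemma mult_AP:
  assumes "u \<in> W" "v \<in> W" shows "E `` {u} \<otimes>\<^bsub>AP\<^esub> E `` {v} = E `` {u @ v}"
proof -
  have "congruent2 E E (\<lambda>u v. E `` {u @ v})"
    by (intro congruent2I' class_eqI amalgam_eq.append) (simp_all add: amalgam_rel_def)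
  from UN_equiv_class2[OF equiv_E equiv_E this assms] show ?thesis
    by (simp add: amalgamated_product_def)
qed

lemma one_AP: "\<one>\<^bsub>AP\<^esub> = E `` {[]}"
  by (simp add: amalgamated_product_def)

lemma inverse_word: "w \<in> W \<Longrightarrow> \<exists>v\<in>W. amalgam_eq A B C i j (v @ w) []"
proof (induction w)
  case Nil
  then show ?case by (auto intro!: amalgam_eq.refl bexI[of _ "[]"])
next
  case (Cons l w)
  then obtain v where v: "v \<in> W" "amalgam_eq A B C i j (v @ w) []" by auto
  have "\<exists>l'. l' \<in> carrier A <+> carrier B \<and> amalgam_eq A B C i j [l', l] []"
  proof (cases l)
    case (Inl a)
    with Cons.prems have a: "a \<in> carrier A" by auto
    have "amalgam_eq A B C i j [Inl (inv\<^bsub>A\<^esub> a), Inl a] [Inl \<one>\<^bsub>A\<^esub>]"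
      using amalgam_eq.mult_left[of "inv\<^bsub>A\<^esub> a" A a] a by simp
    then show ?thesis using Inl a
      by (intro exI[of _ "Inl (inv\<^bsub>A\<^esub> a)"]) (auto intro: amalgam_eq.trans amalgam_eq.one_left)
  next
    case (Inr a)
    with Cons.prems have a: "a \<in> carrier B" by auto
    have "amalgam_eq A B C i j [Inr (inv\<^bsub>B\<^esub> a), Inr a] [Inr \<one>\<^bsub>B\<^esub>]"
      using amalgam_eq.mult_right[of "inv\<^bsub>B\<^esub> a" B a] a by simp
    then show ?thesis using Inr a
      by (intro exI[of _ "Inr (inv\<^bsub>B\<^esub> a)"]) (auto intro: amalgam_eq.trans amalgam_eq.one_right)
  qed
  then obtain l' where l': "l' \<in> carrier A <+> carrier B" "amalgam_eq A B C i j [l', l] []" by auto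
  have "amalgam_eq A B C i j (v @ ([l', l] @ w)) (v @ ([] @ w))"
    using Cons.prems v l' by (intro amalgam_eq.append amalgam_eq.refl) auto
  then have "amalgam_eq A B C i j ((v @ [l']) @ l # w) []"
    using amalgam_eq.trans v by fastforce
  then show ?case using v l' by (intro bexI[of _ "v @ [l']"]) auto
qed

lemma group_AP: "group AP"
proof (rule groupI)
  show "\<one>\<^bsub>AP\<^esub> \<in> carrier AP" by (simp add: one_AP class_in_AP)
next
  fix X assume "X \<in> carrier AP"
  then obtain u where u: "u \<in> W" "X = E `` {u}" by (rule AP_cases)
  show "\<one>\<^bsub>AP\<^esub> \<otimes>\<^bsub>AP\<^esub> X = X" unfolding u one_AP using u by (subst mult_AP) simp_all
  obtain u' where u': "u' \<in> W" "amalgam_eq A B C i j (u' @ u) []" using inverse_word u by blast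
  show "\<exists>Y\<in>carrier AP. Y \<otimes>\<^bsub>AP\<^esub> X = \<one>\<^bsub>AP\<^esub>"
    unfolding u one_AP using u u'
    by (intro bexI[of _ "E `` {u'}"] class_in_AP) (simp_all add: mult_AP class_eqI)
  fix Y assume "Y \<in> carrier AP"
  then obtain v where v: "v \<in> W" "Y = E `` {v}" by (rule AP_cases)
  show "X \<otimes>\<^bsub>AP\<^esub> Y \<in> carrier AP"
    using u v class_in_AP[of "u @ v"] by (simp add: mult_AP)
  fix Z assume "Z \<in> carrier AP"
  then obtain w where w: "w \<in> W" "Z = E `` {w}" by (rule AP_cases)
  have "u @ v \<in> W" "v @ w \<in> W" using u v w by simp_all
  then show "X \<otimes>\<^bsub>AP\<^esub> Y \<otimes>\<^bsub>AP\<^esub> Z = X \<otimes>\<^bsub>AP\<^esub> (Y \<otimes>\<^bsub>AP\<^esub> Z)"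
    by (simp only: u v w mult_AP append_assoc)
qed

lemma Inl_hom: "(\<lambda>a. E `` {[Inl a]}) \<in> hom A AP"
proof (rule homI)
  fix a a' assume a: "a \<in> carrier A" "a' \<in> carrier A"
  then have "E `` {[Inl a]} \<otimes>\<^bsub>AP\<^esub> E `` {[Inl a']} = E `` {[Inl a, Inl a']}"
    by (subst mult_AP) auto
  also have "\<dots> = E `` {[Inl (a \<otimes>\<^bsub>A\<^esub> a')]}"
    using a by (intro class_eqI amalgam_eq.mult_left)
  finally show "E `` {[Inl (a \<otimes>\<^bsub>A\<^esub> a')]} = E `` {[Inl a]} \<otimes>\<^bsub>AP\<^esub> E `` {[Inl a']}" ..
qed (auto simp: carrier_AP intro!: quotientI)

lemma Inr_hom: "(\<lambda>a. E `` {[Inr a]}) \<in> hom B AP"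
proof (rule homI)
  fix a a' assume a: "a \<in> carrier B" "a' \<in> carrier B"
  then have "E `` {[Inr a]} \<otimes>\<^bsub>AP\<^esub> E `` {[Inr a']} = E `` {[Inr a, Inr a']}"
    by (subst mult_AP) auto
  also have "\<dots> = E `` {[Inr (a \<otimes>\<^bsub>B\<^esub> a')]}"
    using a by (intro class_eqI amalgam_eq.mult_right)
  finally show "E `` {[Inr (a \<otimes>\<^bsub>B\<^esub> a')]} = E `` {[Inr a]} \<otimes>\<^bsub>AP\<^esub> E `` {[Inr a']}" ..
qed (auto simp: carrier_AP intro!: quotientI)

lemma amalgamated: "c \<in> carrier C \<Longrightarrow> E `` {[Inl (i c)]} = E `` {[Inr (j c)]}"
  by (intro class_eqI amalgam_eq.amalgamate)

context
  fixes G :: "('g, 'p) monoid_scheme" and f :: "'a \<Rightarrow> 'g" and g :: "'b \<Rightarrow> 'g"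
  assumes G: "group G" and f: "f \<in> hom A G" and g: "g \<in> hom B G"
    and fg: "\<And>c. c \<in> carrier C \<Longrightarrow> f (i c) = g (j c)"
begin

interpretation G: group G by (fact G)

lemma word_value_closed: "w \<in> W \<Longrightarrow> word_value G f g w \<in> carrier G"
  by (induction w) (use f g in \<open>auto simp: word_value_def hom_def Pi_def\<close>)

lemma word_value_append:
  "u \<in> W \<Longrightarrow> v \<in> W \<Longrightarrow>
     word_value G f g (u @ v) = word_value G f g u \<otimes>\<^bsub>G\<^esub> word_value G f g v"
proof (induction u)
  case Nil
  then show ?case using word_value_closed[of v] by (simp add: word_value_def)
next
  case (Cons l u)
  have "case_sum f g l \<in> carrier G" using Cons.prems f g by (auto simp: hom_def Pi_def)
  then show ?case using Cons word_value_closed[of u] word_value_closed[of v]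
    by (simp add: word_value_def G.m_assoc)
qed

lemma word_value_cong: "amalgam_eq A B C i j u v \<Longrightarrow> word_value G f g u = word_value G f g v"
proof (induction rule: amalgam_eq.induct)
  case (append u u' v v')
  then show ?case using amalgam_eq_words by (metis word_value_append)
next
  case one_left
  then show ?case using hom_one[OF f A.group_axioms G] by (simp add: word_value_def)
next
  case one_right
  then show ?case using hom_one[OF g B.group_axioms G] by (simp add: word_value_def)
next
  case (mult_left a a')
  then show ?case using f by (simp add: word_value_def hom_def Pi_def)
next
  case (mult_right a a')
  then show ?case using g by (simp add: word_value_def hom_def Pi_def)
next
  case (amalgamate c)
  then show ?case using fg by (simp add: word_value_def)
qed auto

lemma amalgam_map_class:
  assumes "w \<in> W" shows "amalgam_map G f g (E `` {w}) = word_value G f g w"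
proof -
  have "word_value G f g ` (E `` {w}) = {word_value G f g w}"
    using assms word_value_cong amalgam_eq.refl by (fastforce simp: amalgam_rel_def image_iff)
  then show ?thesis by (simp add: amalgam_map_def)
qed

lemma amalgam_map_hom: "amalgam_map G f g \<in> hom AP G"
proof (rule homI)
  fix X assume "X \<in> carrier AP"
  then obtain u where u: "u \<in> W" "X = E `` {u}" by (rule AP_cases)
  show "amalgam_map G f g X \<in> carrier G"
    using u by (simp only: amalgam_map_class word_value_closed)
  fix Y assume "Y \<in> carrier AP"
  then obtain v where v: "v \<in> W" "Y = E `` {v}" by (rule AP_cases)
  have "u @ v \<in> W" using u v by simp
  then show "amalgam_map G f g (X \<otimes>\<^bsub>AP\<^esub> Y) = amalgam_map G f g X \<otimes>\<^bsub>G\<^esub> amalgam_map G f g Y"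
    using u v by (simp only: mult_AP amalgam_map_class word_value_append)
qed

lemma amalgam_map_Inl: "a \<in> carrier A \<Longrightarrow> amalgam_map G f g (E `` {[Inl a]}) = f a"
  using f by (subst amalgam_map_class) (auto simp: word_value_def hom_def Pi_def)

lemma amalgam_map_Inr: "b \<in> carrier B \<Longrightarrow> amalgam_map G f g (E `` {[Inr b]}) = g b"
  using g by (subst amalgam_map_class) (auto simp: word_value_def hom_def Pi_def)

lemma amalgam_map_unique:
  assumes h: "h \<in> hom AP G"
    and hf: "\<And>a. a \<in> carrier A \<Longrightarrow> h (E `` {[Inl a]}) = f a"
    and hg: "\<And>b. b \<in> carrier B \<Longrightarrow> h (E `` {[Inr b]}) = g b"
    and X: "X \<in> carrier AP"
  shows "h X = amalgam_map G f g X"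
proof -
  obtain w where w: "w \<in> W" "X = E `` {w}" using X by (rule AP_cases)
  have "h (E `` {w}) = word_value G f g w" using w(1)
  proof (induction w)
    case Nil
    then show ?case using hom_one[OF h group_AP G] by (simp add: one_AP word_value_def)
  next
    case (Cons l w)
    then have lw: "[l] \<in> W" "w \<in> W" by auto
    have "h (E `` {l # w}) = h (E `` {[l]} \<otimes>\<^bsub>AP\<^esub> E `` {w})"
      using mult_AP[OF lw] by simp
    also have "\<dots> = h (E `` {[l]}) \<otimes>\<^bsub>G\<^esub> h (E `` {w})"
      using h lw by (intro hom_mult) (auto simp: carrier_AP intro!: quotientI)
    also have "\<dots> = word_value G f g (l # w)"
      using Cons hf hg by (auto simp: word_value_def)
    finally show ?case .
  qed
  then show ?thesis using w amalgam_map_class by simp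
qed

end

end

end

theory Submission
  imports Defs
begin

text \<open>Put \<open>orb g = g x0\<close>.  Suppose that \<open>a \<in> Q\<close> and \<open>b \<in> R\<close> cannot be shortened by sliding an element of
  \<open>Q \<inter> R\<close> between \<open>inv a\<close> and \<open>b\<close>.  Then the Gromov product of \<open>orb a\<close> and \<open>orb b\<close> at \<open>x0\<close> is
  bounded: otherwise the geodesics from \<open>x0\<close> to these points fellow-travel for a long time, and near
  the point where they diverge, or where one of them leaves the horoball containing that point, there
  is an element of \<open>Q \<inter> R\<close>; outside the horoballs it comes from quasiconvexity, inside a horoball
  from compatibility of the parabolic subgroups.

  An element of the amalgam of \<open>Q'\<close> and \<open>R'\<close> is represented by a word of minimal length whose letters
  are almost as short as possible in total.  It spells a broken geodesic with bounded Gromov products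
  at the vertices, which is not closed if all elements of \<open>Q'\<close> and \<open>R'\<close> outside of \<open>Q \<inter> R\<close> are long.
  By separability, this holds for suitable subgroups of finite index that contain \<open>Q \<inter> R\<close>.\<close>

section \<open>Geodesics and the Gromov product\<close>

text \<open>The definition of a horoball allows constants that depend on the horoball, whereas the
  estimates have to be uniform. Uniformity comes from finiteness: there are finitely many orbits of
  horoballs, finitely many group elements of bounded displacement, and finitely many horoballs with
  a deep point near a given point. The obstacle is a geodesic crossing a horoball \<open>H\<close>,
  in whose interior quasiconvexity says nothing. At the entrance there is \<open>c\<close> in
  \<open>Q \<inter> R\<close> with \<open>orb c\<close> nearby. Quasiconvexity of \<open>Q\<close>
  supplies an element of \<open>Q\<close> that stabilizes \<open>H\<close> and moves
  \<open>orb c\<close> close to the exit of the geodesic to \<open>orb a\<close>; likewise for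
  \<open>R\<close> and \<open>orb b\<close>. These two elements need not be related, but
  compatibility puts one of them into the other subgroup, and so decides which exit is used. This
  exit comes after the divergence point, but a detour through it still saves about twice the Gromov
  product. Sliding compares total lengths of words only, so a single almost shortest word makes all
  adjacent pairs of letters nearly unshortenable at once.\<close>

lemma geodesic_path_dist:
  assumes "geodesic_path x y c" "s \<in> {0..dist x y}" "t \<in> {0..dist x y}"
  shows "dist (c s) (c t) = \<bar>s - t\<bar>"
  using assms by (auto simp: geodesic_path_def)

lemma geodesic_path_ends:
  assumes "geodesic_path x y c"
  shows "c 0 = x" "c (dist x y) = y"
  using assms by (auto simp: geodesic_path_def)

lemma geodesic_path_dist_start:
  assumes "geodesic_path x y c" "t \<in> {0..dist x y}"
  shows "dist x (c t) = t"
  using geodesic_path_dist[OF assms(1), of 0 t] geodesic_path_ends[OF assms(1)] assms(2) by auto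

lemma geodesic_path_dist_end:
  assumes "geodesic_path x y c" "t \<in> {0..dist x y}"
  shows "dist (c t) y = dist x y - t"
  using geodesic_path_dist[OF assms(1), of t "dist x y"] geodesic_path_ends[OF assms(1)] assms(2)
  by auto

lemma geodesic_path_sub:
  assumes "geodesic_path x y c" "0 \<le> u" "u \<le> v" "v \<le> dist x y"
  shows "geodesic_path (c u) (c v) (\<lambda>t. c (u + t))"
proof -
  have "dist (c u) (c v) = v - u" using geodesic_path_dist[OF assms(1), of u v] assms by auto
  then show ?thesis using assms geodesic_path_dist[OF assms(1)] by (auto simp: geodesic_path_def)
qed

lemma geodesic_path_continuous:
  assumes "geodesic_path x y c"
  shows "continuous_on {0..dist x y} c"
  unfolding continuous_on_iff
proof (intro ballI allI impI)
  fix s e :: real assume "s \<in> {0..dist x y}" "0 < e"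
  then show "\<exists>d>0. \<forall>t\<in>{0..dist x y}. dist t s < d \<longrightarrow> dist (c t) (c s) < e"
    using geodesic_path_dist[OF assms] by (intro exI[of _ e]) (auto simp: dist_real_def)
qed

lemma geodesic_path_segment:
  "geodesic_path x y c \<Longrightarrow> geodesic_segment x y (c ` {0..dist x y})"
  by (auto simp: geodesic_segment_def)

lemma geodesic_segment_sub:
  assumes "geodesic_path x y c" "0 \<le> u" "u \<le> v" "v \<le> dist x y"
  shows "geodesic_segment (c u) (c v) (c ` {u..v})"
proof -
  have d: "dist (c u) (c v) = v - u" using geodesic_path_dist[OF assms(1), of u v] assms by auto
  have "c ` {u..v} = (\<lambda>t. c (u + t)) ` {0..v - u}"
  proof -
    have "{u..v} = (\<lambda>t. u + t) ` {0..v - u}" by (simp add: image_add_atLeastAtMost)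
    then show ?thesis by (metis image_image)
  qed
  then show ?thesis using geodesic_path_segment[OF geodesic_path_sub[OF assms]] d by simp
qed

lemma geodesic_segment_ends:
  assumes "geodesic_segment x y S" shows "x \<in> S" "y \<in> S"
proof -
  obtain c where c: "geodesic_path x y c" "S = c ` {0..dist x y}"
    using assms by (auto simp: geodesic_segment_def)
  show "x \<in> S" "y \<in> S" unfolding c(2) using geodesic_path_ends[OF c(1)]
    by (metis atLeastAtMost_iff image_eqI order_refl zero_le_dist)+
qed

lemma geodesic_segment_dist:
  assumes "geodesic_segment x y S" "p \<in> S" shows "dist x p + dist p y = dist x y"
proof -
  obtain c where c: "geodesic_path x y c" "S = c ` {0..dist x y}"
    using assms by (auto simp: geodesic_segment_def)
  then obtain t where "t \<in> {0..dist x y}" "p = c t" using assms by auto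
  then show ?thesis using geodesic_path_dist_start[OF c(1)] geodesic_path_dist_end[OF c(1)] by simp
qed

lemma geodesic_path_reverse:
  assumes "geodesic_path x y c"
  shows "geodesic_path y x (\<lambda>t. c (dist x y - t))"
  using assms by (auto simp: geodesic_path_def dist_commute)

lemma geodesic_segment_commute:
  assumes "geodesic_segment x y S" shows "geodesic_segment y x S"
proof -
  obtain c where c: "geodesic_path x y c" "S = c ` {0..dist x y}"
    using assms by (auto simp: geodesic_segment_def)
  have "(\<lambda>t. dist x y - t) ` {0..dist x y} = {0..dist x y}" by (simp add: image_diff_atLeastAtMost)
  then have "S = (\<lambda>t. c (dist x y - t)) ` {0..dist y x}"
    unfolding c(2) by (metis dist_commute image_image)
  then show ?thesis using geodesic_path_segment[OF geodesic_path_reverse[OF c(1)]] by simp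
qed

lemma geodesic_ray_path:
  assumes "geodesic_ray c" "0 \<le> t"
  shows "geodesic_path (c 0) (c t) c" "dist (c 0) (c t) = t"
proof -
  show "dist (c 0) (c t) = t" using assms by (simp add: geodesic_ray_def)
  then show "geodesic_path (c 0) (c t) c" using assms by (auto simp: geodesic_path_def geodesic_ray_def)
qed

definition gromov_product :: "'x::metric_space \<Rightarrow> 'x \<Rightarrow> 'x \<Rightarrow> real" where
  "gromov_product w x y = (dist w x + dist w y - dist x y) / 2"

lemma gromov_product_commute: "gromov_product w x y = gromov_product w y x"
  by (simp add: gromov_product_def dist_commute)

lemma gromov_product_nonneg: "0 \<le> gromov_product w x y"
  using dist_triangle[of x y w] by (simp add: gromov_product_def dist_commute)

lemma gromov_product_le_left: "gromov_product w x y \<le> dist w x"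
  using dist_triangle[of w y x] by (simp add: gromov_product_def)

lemma gromov_product_le_right: "gromov_product w x y \<le> dist w y"
  using gromov_product_le_left gromov_product_commute by metis

lemma gromov_product_shift: "gromov_product w x y + gromov_product x w y = dist w x"
  by (simp add: gromov_product_def dist_commute field_simps)

lemma gromov_product_le_dist_segment:
  assumes "geodesic_segment x y S" "p \<in> S"
  shows "gromov_product w x y \<le> dist w p"
  using geodesic_segment_dist[OF assms] dist_triangle[of w x p] dist_triangle[of w y p]
  by (simp add: gromov_product_def dist_commute)

lemma infdist_less_obtain:
  assumes "A \<noteq> {}" "infdist x A < e"
  obtains a where "a \<in> A" "dist x a < e"
proof -
  have "\<exists>a\<in>A. dist x a < e" using assms by (auto simp: infdist_def cINF_less_iff)
  then show ?thesis using that by auto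
qed

section \<open>Slim triangles and the four-point inequality\<close>

locale slim_space =
  fixes \<delta> :: real and X :: "'x::metric_space itself"
  assumes slim: "hyperbolic_space \<delta> X" and geod: "geodesic_space X" and \<delta>_nonneg: "0 \<le> \<delta>"
begin

lemma geodesic_exists: obtains S where "geodesic_segment (x::'x) y S"
  using geod by (auto simp: geodesic_space_def)

lemma geodesic_path_exists: obtains c where "geodesic_path (x::'x) y c"
  using geodesic_exists[of x y] by (auto simp: geodesic_segment_def)

lemma slimD:
  assumes "geodesic_segment (x::'x) y S" "geodesic_segment y z T" "geodesic_segment x z V" "p \<in> S"
  shows "\<exists>q\<in>T \<union> V. dist p q \<le> \<delta>"
  using slim assms unfolding hyperbolic_space_def by blast

text \<open>By the intermediate value theorem some point \<open>p\<close> of \<open>S\<close> is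
  equally far from the two other sides. Slimness puts it within \<open>\<delta>\<close> of one,
  hence of both; adding four triangle inequalities bounds twice its distance to \<open>w\<close>.
  The margin in \<open>\<delta> + 1\<close> turns infimum distances into actual points.\<close>

lemma dist_segment_le_gromov_product:
  assumes S: "geodesic_segment (x::'x) y S"
  shows "\<exists>p\<in>S. dist w p \<le> gromov_product w x y + 2 * \<delta> + 2"
proof -
  obtain c where c: "geodesic_path x y c" "S = c ` {0..dist x y}"
    using S by (auto simp: geodesic_segment_def)
  obtain V where V: "geodesic_segment x w V" by (rule geodesic_exists)
  obtain T where T: "geodesic_segment y w T" by (rule geodesic_exists)
  note ends = geodesic_segment_ends[OF V] geodesic_segment_ends[OF T]
  define f where "f t = infdist (c t) V - infdist (c t) T" for t
  have "continuous_on {0..dist x y} f"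
    unfolding f_def by (intro continuous_intros continuous_on_infdist geodesic_path_continuous[OF c(1)])
  moreover have "f 0 \<le> 0" "0 \<le> f (dist x y)"
    using ends by (simp_all add: f_def geodesic_path_ends[OF c(1)] infdist_nonneg)
  ultimately obtain t where t: "0 \<le> t" "t \<le> dist x y" "f t = 0"
    using IVT'[of f 0 0 "dist x y"] by auto
  define p where "p = c t"
  have pS: "p \<in> S" using t by (auto simp: p_def c(2))
  then obtain q where q: "q \<in> T \<union> V" "dist p q \<le> \<delta>" using slimD[OF S T V] by auto
  have eq: "infdist p V = infdist p T" using t by (simp add: f_def p_def)
  have "infdist p V \<le> \<delta> \<or> infdist p T \<le> \<delta>" using q by (auto intro: infdist_le2)
  then have lt: "infdist p V < \<delta> + 1" "infdist p T < \<delta> + 1" using eq by auto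
  obtain a where a: "a \<in> V" "dist p a < \<delta> + 1"
    using infdist_less_obtain[OF _ lt(1)] ends by auto
  obtain b where b: "b \<in> T" "dist p b < \<delta> + 1"
    using infdist_less_obtain[OF _ lt(2)] ends by auto
  have "dist w p \<le> dist w a + dist p a" "dist w p \<le> dist w b + dist p b"
    "dist x p \<le> dist x a + dist p a" "dist p y \<le> dist b y + dist p b"
    using dist_triangle[of w p a] dist_triangle[of w p b] dist_triangle[of x p a]
      dist_triangle[of p y b] by (simp_all add: dist_commute)
  then have "dist w p \<le> gromov_product w x y + 2 * \<delta> + 2"
    using a b geodesic_segment_dist[OF V a(1)] geodesic_segment_dist[OF T b(1)]
      geodesic_segment_dist[OF S pS]
    by (simp add: gromov_product_def dist_commute field_simps)
  then show ?thesis using pS by blast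
qed

text \<open>Slimness moves the point of \<open>dist_segment_le_gromov_product\<close> by at most
  \<open>\<delta>\<close> to a side ending in \<open>z\<close>, and the distance from
  \<open>w\<close> to that side is at least the Gromov product of its endpoints. The constant is
  \<open>2 * \<delta> + 2\<close> plus \<open>\<delta>\<close>.\<close>

lemma four_point:
  "min (gromov_product w x z) (gromov_product w z y) \<le> gromov_product w (x::'x) y + (3 * \<delta> + 2)"
proof -
  obtain S where S: "geodesic_segment x y S" by (rule geodesic_exists)
  obtain V where V: "geodesic_segment x z V" by (rule geodesic_exists)
  obtain T where T: "geodesic_segment y z T" by (rule geodesic_exists)
  obtain p where p: "p \<in> S" "dist w p \<le> gromov_product w x y + 2 * \<delta> + 2"
    using dist_segment_le_gromov_product[OF S] by blast
  obtain q where q: "q \<in> T \<union> V" "dist p q \<le> \<delta>" using slimD[OF S T V p(1)] by auto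
  have "dist w q \<le> gromov_product w x y + (3 * \<delta> + 2)"
    using p q dist_triangle[of w q p] by simp
  moreover have "gromov_product w x z \<le> dist w q \<or> gromov_product w z y \<le> dist w q"
    using q gromov_product_le_dist_segment[OF V] gromov_product_le_dist_segment[OF T]
    by (auto simp: gromov_product_commute)
  ultimately show ?thesis by auto
qed

text \<open>At \<open>w\<close>, the products of \<open>\<alpha> t\<close> with \<open>x\<close> and
  of \<open>y\<close> with \<open>\<beta> t\<close> equal \<open>t\<close>, so passing along
  \<open>\<alpha> t\<close>, \<open>x\<close>, \<open>y\<close>, \<open>\<beta> t\<close> by two
  uses of the four-point inequality loses at most twice its constant.\<close>

lemma fellow_travel:
  assumes \<alpha>: "geodesic_path (w::'x) x \<alpha>" and \<beta>: "geodesic_path w y \<beta>"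
    and t: "0 \<le> t" "t \<le> gromov_product w x y"
  shows "dist (\<alpha> t) (\<beta> t) \<le> 4 * (3 * \<delta> + 2)"
proof -
  have tx: "t \<in> {0..dist w x}" "t \<in> {0..dist w y}"
    using t gromov_product_le_left[of w x y] gromov_product_le_right[of w x y] by auto
  have "gromov_product w (\<alpha> t) x = t" "gromov_product w y (\<beta> t) = t"
    using geodesic_path_dist_start[OF \<alpha> tx(1)] geodesic_path_dist_end[OF \<alpha> tx(1)]
      geodesic_path_dist_start[OF \<beta> tx(2)] geodesic_path_dist_end[OF \<beta> tx(2)]
    by (simp_all add: gromov_product_def dist_commute)
  then have "t - 2 * (3 * \<delta> + 2) \<le> gromov_product w (\<alpha> t) (\<beta> t)"
    using four_point[of w "\<alpha> t" x y] four_point[of w "\<alpha> t" y "\<beta> t"] t \<delta>_nonneg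
    by (simp add: min_def split: if_splits)
  then show ?thesis
    using geodesic_path_dist_start[OF \<alpha> tx(1)] geodesic_path_dist_start[OF \<beta> tx(2)]
    by (simp add: gromov_product_def field_simps)
qed

end

section \<open>Rays and horoballs\<close>

text \<open>Filters are used instead of subsequences because an uncountable product of balls is
  compact but need not be sequentially compact.\<close>

lemma cluster_point_in_closed:
  assumes "closed A" "eventually (\<lambda>f. f \<in> A) F" "inf (nhds a) F \<noteq> bot"
  shows "a \<in> A"
proof (rule ccontr)
  assume "a \<notin> A"
  then have "eventually (\<lambda>f. f \<in> - A) (nhds a)"
    using assms(1) by (intro eventually_nhds_in_open) auto
  then have "eventually (\<lambda>_. False) (inf (nhds a) F)"
    unfolding eventually_inf using assms(2)
    by (intro exI[of _ "\<lambda>f. f \<in> - A"] exI[of _ "\<lambda>f. f \<in> A"]) auto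
  then show False using assms(3) by (simp add: eventually_False)
qed

context slim_space
begin

text \<open>In the triangle with vertices \<open>c 0\<close>, \<open>c T\<close>, \<open>x\<close>
  the point \<open>c t\<close> is \<open>\<delta>\<close>-close either to \<open>b\<close>, at a
  nearby parameter, or to the side from \<open>c 0\<close> to \<open>x\<close>, in which case
  \<open>t\<close> is small.\<close>

lemma ray_fellow_travel:
  assumes c: "geodesic_ray (c :: real \<Rightarrow> 'x)" and b: "geodesic_path x (c T) b"
    and t: "0 \<le> t" "t \<le> T" "t \<le> dist x (c T)"
  shows "dist (b t) (c t) \<le> 2 * \<delta> + 3 * dist x (c 0)"
proof -
  have T: "0 \<le> T" using t by simp
  note cp = geodesic_ray_path[OF c T]
  have S: "geodesic_segment (c 0) (c T) (c ` {0..T})"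
    using geodesic_path_segment[OF cp(1)] cp(2) by simp
  obtain V where V: "geodesic_segment (c 0) x V" by (rule geodesic_exists)
  have B: "geodesic_segment x (c T) (b ` {0..dist x (c T)})"
    by (rule geodesic_path_segment[OF b])
  have "c t \<in> c ` {0..T}" using t by auto
  then obtain q where q: "q \<in> b ` {0..dist x (c T)} \<union> V" "dist (c t) q \<le> \<delta>"
    using slimD[OF S geodesic_segment_commute[OF B] V] by blast
  have ct: "dist (c 0) (c t) = t" using geodesic_ray_path[OF c t(1)] by simp
  have bt: "dist x (b t) = t" using geodesic_path_dist_start[OF b] t by auto
  show ?thesis
  proof (cases "q \<in> V")
    case True
    then have "dist (c 0) q \<le> dist (c 0) x"
      using geodesic_segment_dist[OF V True] zero_le_dist[of q x] by linarith
    then have "t \<le> dist x (c 0) + \<delta>"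
      using ct q dist_triangle[of "c 0" "c t" q] by (simp add: dist_commute)
    then show ?thesis using dist_triangle[of "b t" "c t" x] dist_triangle[of x "c t" "c 0"] ct bt
      by (simp add: dist_commute)
  next
    case False
    then obtain u where u: "u \<in> {0..dist x (c T)}" "q = b u" using q by auto
    have "dist x q = u" using geodesic_path_dist_start[OF b u(1)] u by simp
    then have "\<bar>u - t\<bar> \<le> dist x (c 0) + \<delta>"
      using q ct dist_triangle[of x q "c 0"] dist_triangle[of "c 0" q "c t"]
        dist_triangle[of "c 0" "c t" x] dist_triangle[of x "c t" q]
      by (simp add: dist_commute)
    moreover have "dist (b t) q = \<bar>t - u\<bar>" using geodesic_path_dist[OF b, of t u] u t by auto
    moreover have "dist (b t) (c t) \<le> dist (b t) q + dist (c t) q"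
      using dist_triangle[of "b t" "c t" q] by (simp add: dist_commute)
    ultimately show ?thesis using q zero_le_dist[of x "c 0"] by linarith
  qed
qed

text \<open>By compactness of products, the geodesics from \<open>x\<close> to the points \<open>c n\<close> cluster at a ray.\<close>

lemma ray_exists:
  assumes pr: "proper_space X" and c: "geodesic_ray (c :: real \<Rightarrow> 'x)"
  shows "\<exists>a. geodesic_ray a \<and> a 0 = x \<and> (\<forall>t\<ge>0. dist (a t) (c t) \<le> 2 * \<delta> + 3 * dist x (c 0))"
proof -
  have "\<exists>b. geodesic_path x (c (real n)) b" for n by (rule geodesic_path_exists) blast
  then obtain b where b: "\<And>n. geodesic_path x (c (real n)) (b n)" by metis
  \<comment> \<open>The geodesics are frozen at \<open>c (real n)\<close> after their end and at
    \<open>x\<close> for negative times, so that every \<open>f n\<close> lies in the product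
    \<open>K\<close> of closed balls, which is compact by Tychonoff's theorem.\<close>
  define f where "f n t = (if 0 \<le> t then b n (min t (dist x (c (real n)))) else x)" for n t
  define K :: "(real \<Rightarrow> 'x) set" where "K = PiE UNIV (\<lambda>t. cball x (max t 0))"
  have "compactin (product_topology (\<lambda>_. euclidean) UNIV) K"
    unfolding K_def compactin_PiE using pr by (auto simp: proper_space_def)
  then have "compact K" by (simp add: euclidean_product_topology)
  moreover have "f n \<in> K" for n
  proof -
    have "dist x (f n t) \<le> max t 0" for t
      using geodesic_path_dist_start[OF b, of "min t (dist x (c (real n)))" n]
      by (auto simp: f_def)
    then show ?thesis by (auto simp: K_def)
  qed
  ultimately obtain a where a: "inf (nhds a) (filtermap f sequentially) \<noteq> bot"
    using compact_filter[of K]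
    by (auto simp: eventually_filtermap filtermap_bot_iff dest!: spec[of _ "filtermap f sequentially"])
  have large: "eventually (\<lambda>n. t \<le> real n \<and> t \<le> dist x (c (real n))) sequentially" for t
  proof -
    have "eventually (\<lambda>n. \<bar>t\<bar> + dist x (c 0) \<le> real n) sequentially"
      using filterlim_real_sequentially by (simp add: filterlim_at_top)
    then show ?thesis
    proof eventually_elim
      case (elim n)
      have "dist (c 0) (c (real n)) = real n" using geodesic_ray_path[OF c, of "real n"] by simp
      then show ?case using elim dist_triangle[of "c 0" "c (real n)" x] zero_le_dist[of x "c 0"]
          abs_ge_self[of t] dist_commute[of x "c 0"] by linarith
    qed
  qed
  have coord: "continuous_on UNIV (\<lambda>g :: real \<Rightarrow> 'x. g t)" for t by simp
  \<comment> \<open>Each of the required properties is a family of closed conditions on at most two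
    coordinates, holding for \<open>f n\<close> eventually; they pass to the cluster point
    \<open>a\<close>.\<close>
  have "dist (a s) (a t) = \<bar>s - t\<bar>" if st: "0 \<le> s" "0 \<le> t" for s t
  proof -
    have "closed {g :: real \<Rightarrow> 'x. dist (g s) (g t) = \<bar>s - t\<bar>}"
      by (intro closed_Collect_eq continuous_intros coord)
    moreover have "eventually (\<lambda>n. dist (f n s) (f n t) = \<bar>s - t\<bar>) sequentially"
      using large[of s] large[of t]
    proof eventually_elim
      case (elim n)
      then show ?case using st geodesic_path_dist[OF b[of n], of s t] by (simp add: f_def min_def)
    qed
    ultimately have "a \<in> {g. dist (g s) (g t) = \<bar>s - t\<bar>}"
      using a by (intro cluster_point_in_closed) (auto simp: eventually_filtermap)
    then show ?thesis by simp
  qed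
  then have "geodesic_ray a" by (simp add: geodesic_ray_def)
  moreover have "dist (a t) (c t) \<le> 2 * \<delta> + 3 * dist x (c 0)" if t: "0 \<le> t" for t
  proof -
    have "closed {g :: real \<Rightarrow> 'x. dist (g t) (c t) \<le> 2 * \<delta> + 3 * dist x (c 0)}"
      by (intro closed_Collect_le continuous_intros coord)
    moreover have "eventually (\<lambda>n. dist (f n t) (c t) \<le> 2 * \<delta> + 3 * dist x (c 0)) sequentially"
      using large[of t]
    proof eventually_elim
      case (elim n)
      then show ?case using t ray_fellow_travel[OF c b[of n], of t] by (simp add: f_def min_def)
    qed
    ultimately have "a \<in> {g. dist (g t) (c t) \<le> 2 * \<delta> + 3 * dist x (c 0)}"
      using a by (intro cluster_point_in_closed) (auto simp: eventually_filtermap)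
    then show ?thesis by simp
  qed
  moreover have "a 0 = x"
  proof -
    have "closed {g :: real \<Rightarrow> 'x. g 0 = x}" by (intro closed_Collect_eq continuous_intros coord)
    moreover have "f n 0 = x" for n using geodesic_path_ends[OF b[of n]] by (simp add: f_def)
    ultimately have "a \<in> {g. g 0 = x}"
      using a by (intro cluster_point_in_closed) (auto simp: eventually_filtermap)
    then show ?thesis by simp
  qed
  ultimately show ?thesis by blast
qed

section \<open>Rays towards a boundary point and horofunctions\<close>

lemma equiv_asymptotic_rays:
  "equiv {c :: real \<Rightarrow> 'x. geodesic_ray c} asymptotic_rays"
proof (rule equivI)
  show "trans (asymptotic_rays :: ((real \<Rightarrow> 'x) \<times> (real \<Rightarrow> 'x)) set)"
  proof (rule transI)
    fix a b c :: "real \<Rightarrow> 'x"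
    assume "(a, b) \<in> asymptotic_rays" "(b, c) \<in> asymptotic_rays"
    then obtain D E where DE: "\<And>t. t \<ge> 0 \<Longrightarrow> dist (a t) (b t) \<le> D" "\<And>t. t \<ge> 0 \<Longrightarrow> dist (b t) (c t) \<le> E"
      and r: "geodesic_ray a" "geodesic_ray c"
      by (auto simp: asymptotic_rays_def)
    have "dist (a t) (c t) \<le> D + E" if "0 \<le> t" for t
      using DE[OF that] dist_triangle[of "a t" "c t" "b t"] by simp
    then show "(a, c) \<in> asymptotic_rays" using r by (auto simp: asymptotic_rays_def)
  qed
qed (auto simp: asymptotic_rays_def refl_on_def sym_def dist_commute intro: exI[of _ 0])

lemma boundary_rays_asymptotic:
  assumes "(\<xi> :: (real \<Rightarrow> 'x) set) \<in> boundary_at_infinity" "a \<in> \<xi>" "b \<in> \<xi>"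
  shows "\<exists>E. \<forall>t\<ge>0. dist (a t) (b t) \<le> E"
  using quotient_eq_iff[OF equiv_asymptotic_rays, of \<xi> \<xi> a b] assms
  by (auto simp: boundary_at_infinity_def asymptotic_rays_def)

lemma boundary_ray:
  assumes "(\<xi> :: (real \<Rightarrow> 'x) set) \<in> boundary_at_infinity" "a \<in> \<xi>"
  shows "geodesic_ray a"
  using assms in_quotient_imp_subset[OF equiv_asymptotic_rays, of \<xi>]
  by (auto simp: boundary_at_infinity_def)

lemma boundary_ray_from:
  assumes pr: "proper_space X" and \<xi>: "(\<xi> :: (real \<Rightarrow> 'x) set) \<in> boundary_at_infinity"
  obtains a where "a \<in> \<xi>" "a 0 = x" "geodesic_ray a"
proof -
  obtain c where c: "c \<in> \<xi>" 
    using \<xi> in_quotient_imp_non_empty[OF equiv_asymptotic_rays] by (auto simp: boundary_at_infinity_def)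
  have cr: "geodesic_ray c" by (rule boundary_ray[OF \<xi> c])
  obtain a where a: "geodesic_ray a" "a 0 = x" "\<forall>t\<ge>0. dist (a t) (c t) \<le> 2 * \<delta> + 3 * dist x (c 0)"
    using ray_exists[OF pr cr, of x] by auto
  have "(c, a) \<in> asymptotic_rays" using a cr by (auto simp: asymptotic_rays_def dist_commute)
  then have "a \<in> \<xi>" using \<xi> c in_quotient_imp_closed[OF equiv_asymptotic_rays]
    by (auto simp: boundary_at_infinity_def)
  then show ?thesis using that a by blast
qed

text \<open>Cut both rays off at a large time \<open>T\<close> and split the quadrilateral with
  corners \<open>a 0\<close>, \<open>b 0\<close>, \<open>b T\<close>, \<open>a T\<close> by a
  diagonal into two slim triangles. The far side has length at most \<open>E\<close>, and
  \<open>T\<close> is so large that this side is out of reach from \<open>m\<close>.\<close>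

lemma ideal_triangle_slim:
  assumes a: "geodesic_ray (a :: real \<Rightarrow> 'x)" and b: "geodesic_ray b"
    and E: "\<forall>t\<ge>0. dist (a t) (b t) \<le> E"
    and S: "geodesic_segment (a 0) (b 0) S" and m: "m \<in> S"
  shows "\<exists>t\<ge>0. dist m (a t) \<le> 2 * \<delta> \<or> dist m (b t) \<le> 2 * \<delta>"
proof -
  define T where "T = 2 * \<delta> + E + dist (a 0) m + 1"
  have "0 \<le> E" using E[rule_format, of 0] zero_le_dist[of "a 0" "b 0"] by linarith
  then have T: "0 \<le> T" using \<delta>_nonneg by (simp add: T_def)
  note ap = geodesic_ray_path[OF a T] and bp = geodesic_ray_path[OF b T]
  have A: "geodesic_segment (a 0) (a T) (a ` {0..T})" and B: "geodesic_segment (b 0) (b T) (b ` {0..T})"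
    using geodesic_path_segment[OF ap(1)] geodesic_path_segment[OF bp(1)] ap(2) bp(2) by simp_all
  obtain W where W: "geodesic_segment (a 0) (b T) W" by (rule geodesic_exists)
  obtain V where V: "geodesic_segment (b T) (a T) V" by (rule geodesic_exists)
  obtain w where w: "w \<in> b ` {0..T} \<union> W" "dist m w \<le> \<delta>" using slimD[OF S B W m] by auto
  show ?thesis
  proof (cases "w \<in> W")
    case False
    then obtain t where "0 \<le> t" "w = b t" using w by auto
    then show ?thesis using w \<delta>_nonneg by (intro exI[of _ t]) auto
  next
    case True
    then obtain z where z: "z \<in> V \<union> a ` {0..T}" "dist w z \<le> \<delta>" using slimD[OF W V A True] by auto
    have mz: "dist m z \<le> 2 * \<delta>" using w z dist_triangle[of m z w] by simp
    have "z \<notin> V"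
    proof
      assume "z \<in> V"
      then have "dist z (a T) \<le> E"
        using geodesic_segment_dist[OF V] E T zero_le_dist[of "b T" z]
        by (metis add_increasing dist_commute le_add_same_cancel2 order_trans)
      then have "dist (a 0) (a T) \<le> dist (a 0) m + 2 * \<delta> + E"
        using mz dist_triangle[of "a 0" "a T" m] dist_triangle[of m "a T" z] by simp
      then show False using ap(2) by (simp add: T_def)
    qed
    then obtain t where "0 \<le> t" "z = a t" using z by auto
    then show ?thesis using mz by (intro exI[of _ t]) auto
  qed
qed

text \<open>A vertex close to the opposite ray lies on the two other sides. At such a centre the
  horofunction condition reads \<open>h m = h x + dist x m\<close> up to a bounded error, the form
  in which horofunctions are used below.\<close>

lemma ideal_triangle_centre_vertex:
  assumes "geodesic_segment x m S" "a \<in> \<xi>" "a 0 = x" "b \<in> \<xi>" "b 0 = (m :: 'x)"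
    "0 \<le> t" "dist m (a t) \<le> r"
  shows "ideal_triangle_centre r x m \<xi> m"
proof -
  have r: "0 \<le> r" using assms(7) zero_le_dist[of m "a t"] by linarith
  have "m \<in> S" using geodesic_segment_ends(2)[OF assms(1)] .
  then show ?thesis unfolding ideal_triangle_centre_def using assms r
    by (intro exI[of _ S] exI[of _ a] exI[of _ b] conjI bexI[of _ m])
      (auto intro: exI[of _ 0] exI[of _ t])
qed

text \<open>If \<open>m\<close> lies on a geodesic between two points of a horoball, it is close to the ray from one of
  them, \<open>x\<close> say; hence the horofunction at \<open>m\<close> exceeds that at \<open>x\<close> by about \<open>dist x m\<close>.\<close>

lemma horoball_deep_midpoint:
  assumes pr: "proper_space X" and H: "horoball (H :: 'x set)"
  shows "\<exists>L. \<forall>x y S m z. x \<in> H \<longrightarrow> y \<in> H \<longrightarrow> geodesic_segment x y S \<longrightarrow> m \<in> S \<longrightarrow>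
    L \<le> dist x m \<longrightarrow> L \<le> dist m y \<longrightarrow> dist m z \<le> \<kappa> \<longrightarrow> z \<in> H"
proof -
  obtain \<xi> h D where \<xi>: "\<xi> \<in> boundary_at_infinity" and h: "horofunction \<xi> h"
    and inH: "\<forall>x\<in>H. - D \<le> h x" and outH: "\<forall>x\<in>- H. h x \<le> D"
    using H unfolding horoball_def by blast
  obtain D1 where D1: "\<And>x y w. ideal_triangle_centre (2 * \<delta>) x y \<xi> w \<Longrightarrow>
      \<bar>(h x + dist x w) - (h y + dist y w)\<bar> \<le> D1"
    using h unfolding horofunction_def by metis
  obtain D2 where D2: "\<And>x y w. ideal_triangle_centre \<kappa> x y \<xi> w \<Longrightarrow>
      \<bar>(h x + dist x w) - (h y + dist y w)\<bar> \<le> D2"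
    using h unfolding horofunction_def by metis
  \<comment> \<open>If \<open>z\<close> were outside \<open>H\<close>, then
    \<open>h z \<le> D\<close>; but passing from \<open>x\<close> to \<open>m\<close> to
    \<open>z\<close> gives \<open>h z \<ge> L - D - D1 - D2 - \<bar>\<kappa>\<bar>\<close>, which is
    \<open>D + 1\<close>.\<close>
  define L where "L = 2 * D + D1 + D2 + \<bar>\<kappa>\<bar> + 1"
  have half: "z \<in> H"
    if x: "x \<in> H" and d: "L \<le> dist x m" and a: "a \<in> \<xi>" "a 0 = x" and t: "0 \<le> t" "dist m (a t) \<le> 2 * \<delta>"
      and z: "dist m z \<le> \<kappa>" for x m z a t
  proof (rule ccontr)
    assume "z \<notin> H"
    obtain b where b: "b \<in> \<xi>" "b 0 = m" by (rule boundary_ray_from[OF pr \<xi>])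
    obtain e where e: "e \<in> \<xi>" "e 0 = z" by (rule boundary_ray_from[OF pr \<xi>])
    obtain S where S: "geodesic_segment x m S" by (rule geodesic_exists)
    obtain T where T: "geodesic_segment z m T" by (rule geodesic_exists)
    have "\<bar>(h x + dist x m) - (h m + dist m m)\<bar> \<le> D1"
      by (intro D1 ideal_triangle_centre_vertex[OF S a b t])
    moreover have "\<bar>(h z + dist z m) - (h m + dist m m)\<bar> \<le> D2"
      by (intro D2 ideal_triangle_centre_vertex[OF T e b order_refl]) (simp add: e z)
    ultimately show False
      using inH[rule_format, OF x] outH[rule_format, of z] \<open>z \<notin> H\<close> d z by (simp add: L_def dist_commute)
  qed
  have "z \<in> H" if xy: "x \<in> H" "y \<in> H" and S: "geodesic_segment x y S" "m \<in> S"
    and d: "L \<le> dist x m" "L \<le> dist m y" and z: "dist m z \<le> \<kappa>" for x y S m z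
  proof -
    obtain a where a: "a \<in> \<xi>" "a 0 = x" "geodesic_ray a" by (rule boundary_ray_from[OF pr \<xi>])
    obtain b where b: "b \<in> \<xi>" "b 0 = y" "geodesic_ray b" by (rule boundary_ray_from[OF pr \<xi>])
    obtain E where "\<forall>t\<ge>0. dist (a t) (b t) \<le> E" using boundary_rays_asymptotic[OF \<xi> a(1) b(1)] by auto
    then obtain t where t: "t \<ge> 0" "dist m (a t) \<le> 2 * \<delta> \<or> dist m (b t) \<le> 2 * \<delta>"
      using ideal_triangle_slim[OF a(3) b(3), of E S m] a b S by auto
    show ?thesis using t(2)
    proof
      assume "dist m (a t) \<le> 2 * \<delta>"
      then show ?thesis using half[OF xy(1) d(1) a(1,2) t(1) _ z] by blast
    next
      assume "dist m (b t) \<le> 2 * \<delta>"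
      then show ?thesis using half[OF xy(2) _ b(1,2) t(1) _ z] d(2) by (simp add: dist_commute)
    qed
  qed
  then show ?thesis by blast
qed

text \<open>The horofunction tends to infinity along the rays of its class.\<close>

lemma horoball_contains_ball:
  assumes pr: "proper_space X" and H: "horoball (H :: 'x set)"
  shows "\<exists>p. cball p r \<subseteq> H"
proof -
  obtain \<xi> h D where \<xi>: "\<xi> \<in> boundary_at_infinity" and h: "horofunction \<xi> h"
    and outH: "\<forall>x\<in>- H. h x \<le> D"
    using H unfolding horoball_def by blast
  define r' where "r' = max r 0"
  obtain D1 where D1: "\<And>x y w. ideal_triangle_centre r' x y \<xi> w \<Longrightarrow>
      \<bar>(h x + dist x w) - (h y + dist y w)\<bar> \<le> D1"
    using h unfolding horofunction_def by metis
  obtain a where a: "a \<in> \<xi>" "geodesic_ray a" by (rule boundary_ray_from[OF pr \<xi>])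
  \<comment> \<open>From \<open>a 0\<close> to \<open>p\<close> the function \<open>h\<close> grows
    by at least \<open>t - D1\<close>, and from \<open>p\<close> to \<open>z\<close> it drops by at
    most \<open>D1 + r'\<close>; so this \<open>t\<close> forces \<open>h z > D\<close>.\<close>
  define t where "t = max 0 (2 * D1 + D + r' + 1 - h (a 0))"
  have t: "0 \<le> t" by (simp add: t_def)
  define p where "p = a t"
  obtain b where b: "b \<in> \<xi>" "b 0 = p" by (rule boundary_ray_from[OF pr \<xi>])
  have "z \<in> H" if z: "dist p z \<le> r" for z
  proof (rule ccontr)
    assume "z \<notin> H"
    obtain e where e: "e \<in> \<xi>" "e 0 = z" by (rule boundary_ray_from[OF pr \<xi>])
    obtain S where S: "geodesic_segment (a 0) p S" by (rule geodesic_exists)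
    obtain T where T: "geodesic_segment z p T" by (rule geodesic_exists)
    have "\<bar>(h (a 0) + dist (a 0) p) - (h p + dist p p)\<bar> \<le> D1"
      by (intro D1 ideal_triangle_centre_vertex[OF S a(1) _ b t]) (auto simp: p_def r'_def)
    moreover have "\<bar>(h z + dist z p) - (h p + dist p p)\<bar> \<le> D1"
      by (intro D1 ideal_triangle_centre_vertex[OF T e b order_refl]) (use z in \<open>auto simp: e r'_def\<close>)
    moreover have "dist (a 0) p = t" using geodesic_ray_path[OF a(2) t] by (simp add: p_def)
    moreover have "t \<ge> 2 * D1 + D + r' + 1 - h (a 0)" "dist z p \<le> r'"
      using z by (simp_all add: t_def r'_def dist_commute)
    ultimately show False using outH[rule_format, of z] \<open>z \<notin> H\<close> by simp
  qed
  then show ?thesis by (auto simp: subset_iff)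
qed

end

section \<open>Uniform geometry of the horoballs\<close>

lemma geodesic_path_isometry:
  assumes "\<And>x y. dist (f x) (f y) = dist x y" "geodesic_path x y c"
  shows "geodesic_path (f x) (f y) (f \<circ> c)"
  using assms by (auto simp: geodesic_path_def)

lemma geodesic_segment_isometry:
  assumes "\<And>x y. dist (f x) (f y) = dist x y" "geodesic_segment x y S"
  shows "geodesic_segment (f x) (f y) (f ` S)"
proof -
  obtain c where c: "geodesic_path x y c" "S = c ` {0..dist x y}"
    using assms(2) by (auto simp: geodesic_segment_def)
  then show ?thesis
    using geodesic_path_segment[OF geodesic_path_isometry[OF assms(1) c(1)]] assms(1)
    by (simp add: image_comp)
qed

lemma gromov_product_isometry:
  assumes "\<And>x y. dist (f x) (f y) = dist x y"
  shows "gromov_product (f w) (f x) (f y) = gromov_product w x y"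
  using assms by (simp add: gromov_product_def)

context relatively_hyperbolic
begin

abbreviation V :: "'x set" where "V \<equiv> - \<Union>\<H>"

sublocale group G
  using group_hom by (rule group_hom.axioms(1))

lemma act_mult: "g \<in> carrier G \<Longrightarrow> h \<in> carrier G \<Longrightarrow> \<phi> (g \<otimes> h) x = \<phi> g (\<phi> h x)"
  by (rule composition_rule) auto

lemma act_one: "\<phi> \<one> x = x"
  using id_eq_one by (metis UNIV_I restrict_apply')

lemma act_inv: "g \<in> carrier G \<Longrightarrow> \<phi> (inv g) (\<phi> g x) = x" "g \<in> carrier G \<Longrightarrow> \<phi> g (\<phi> (inv g) x) = x"
  using act_mult[of "inv g" g x] act_mult[of g "inv g" x] by (simp_all add: act_one)

lemma act_dist_inv: "g \<in> carrier G \<Longrightarrow> dist (\<phi> g x) y = dist x (\<phi> (inv g) y)"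
  using isometric[of g x "\<phi> (inv g) y"] by (simp add: act_inv)

lemma act_image_iff: "g \<in> carrier G \<Longrightarrow> \<phi> g x \<in> \<phi> g ` A \<longleftrightarrow> x \<in> A"
  using act_inv(1) by (metis imageE image_eqI)

lemma act_image_mult:
  "g \<in> carrier G \<Longrightarrow> h \<in> carrier G \<Longrightarrow> \<phi> (g \<otimes> h) ` A = \<phi> g ` \<phi> h ` A"
  by (auto simp: act_mult image_comp)

lemma act_image_one: "\<phi> \<one> ` A = A"
  by (simp add: act_one)

lemma act_V: assumes "g \<in> carrier G" "x \<in> V" shows "\<phi> g x \<in> V"
proof
  assume "\<phi> g x \<in> \<Union>\<H>"
  then obtain H where H: "H \<in> \<H>" "\<phi> g x \<in> H" by blast
  then have "x \<in> \<phi> (inv g) ` H" using act_inv(1)[OF assms(1), of x] by (metis image_eqI)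
  moreover have "\<phi> (inv g) ` H \<in> \<H>" using equivariant H assms(1) by simp
  ultimately show False using assms(2) by blast
qed

lemma basepoint_V: "x0 \<in> V"
  using basepoint by simp

lemma slim_space_exists: "\<exists>\<delta>. slim_space \<delta> TYPE('x)"
proof -
  obtain \<delta> where \<delta>: "hyperbolic_space \<delta> TYPE('x)" using hyperbolic by blast
  \<comment> \<open>The degenerate triangle at \<open>x0\<close> forces \<open>\<delta>\<close> to
    be nonnegative.\<close>
  obtain S where S: "geodesic_segment x0 x0 S"
    using geodesic by (auto simp: geodesic_space_def)
  then obtain q where "dist x0 q \<le> \<delta>"
    using \<delta> geodesic_segment_ends(1)[OF S] unfolding hyperbolic_space_def by blast
  then have "0 \<le> \<delta>" using zero_le_dist[of x0 q] by linarith
  then show ?thesis using \<delta> geodesic by (auto simp: slim_space_def)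
qed

definition slim_constant :: real where
  "slim_constant = (SOME \<delta>. slim_space \<delta> TYPE('x))"

sublocale slim_space slim_constant "TYPE('x)"
  unfolding slim_constant_def using slim_space_exists by (rule someI_ex)

lemma compact_cball: "compact (cball (x::'x) r)"
  using proper by (auto simp: proper_space_def)

lemma finite_short_elements: "finite {g \<in> carrier G. dist x0 (\<phi> g x0) \<le> r}"
proof (rule finite_subset[OF _ properly_discontinuous[OF compact_cball[of x0 "\<bar>r\<bar>"]]])
  have "\<phi> g x0 \<in> \<phi> g ` cball x0 \<bar>r\<bar> \<inter> cball x0 \<bar>r\<bar>" if "dist x0 (\<phi> g x0) \<le> r" for g
    using that by auto
  then show "{g \<in> carrier G. dist x0 (\<phi> g x0) \<le> r}
      \<subseteq> {g \<in> carrier G. \<phi> g ` cball x0 \<bar>r\<bar> \<inter> cball x0 \<bar>r\<bar> \<noteq> {}}"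
    by blast
qed

section \<open>Paths that enter and leave horoballs\<close>

lemma horoball_eqI: "H \<in> \<H> \<Longrightarrow> H' \<in> \<H> \<Longrightarrow> x \<in> H \<Longrightarrow> x \<in> H' \<Longrightarrow> H = H'"
  using disjoint_horoballs by (auto simp: pairwise_def disjnt_def)

lemma closed_V: "closed V"
  unfolding closed_def double_complement by (rule open_Union) (use horoballs in blast)

text \<open>\<open>H\<close> and the union of the other horoballs are disjoint open sets covering
  \<open>A\<close>; this uses that every single horoball is open.\<close>

lemma connected_in_horoball:
  assumes A: "connected A" "A \<inter> V = {}" and H: "H \<in> \<H>" "x \<in> H" "x \<in> A"
  shows "A \<subseteq> H"
proof (rule ccontr)
  assume "\<not> A \<subseteq> H"
  moreover have "open H" "open (\<Union>(\<H> - {H}))" using horoballs H by auto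
  moreover have "A \<subseteq> H \<union> \<Union>(\<H> - {H})" using A(2) by auto
  moreover have "H \<inter> \<Union>(\<H> - {H}) \<inter> A = {}" using horoball_eqI[OF H(1)] by auto
  ultimately have "H \<inter> A = {} \<or> \<Union>(\<H> - {H}) \<inter> A = {}"
    using A(1) unfolding connected_def by blast
  then show False using \<open>\<not> A \<subseteq> H\<close> \<open>A \<subseteq> H \<union> \<Union>(\<H> - {H})\<close> H by blast
qed

lemma exit_horoball:
  fixes c :: "real \<Rightarrow> 'x"
  assumes c: "continuous_on {u..v} c" and H: "H \<in> \<H>" "c u \<in> H" and v: "c v \<in> V" "u \<le> v"
  obtains \<tau> where "u < \<tau>" "\<tau> \<le> v" "c \<tau> \<in> V" "c ` {u..<\<tau>} \<subseteq> H"
proof -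
  \<comment> \<open>The exit is the first time in the closed set \<open>V\<close>; before it,
    connectedness keeps the path inside \<open>H\<close>.\<close>
  define T where "T = {u..v} \<inter> c -` V"
  have "closed T" unfolding T_def by (rule continuous_closed_preimage[OF c _ closed_V]) simp
  moreover have "v \<in> T" "T \<subseteq> {u..v}" using v by (auto simp: T_def)
  ultimately have Inf: "Inf T \<in> T" "\<And>t. t \<in> T \<Longrightarrow> Inf T \<le> t"
    by (auto intro!: closed_contains_Inf cInf_lower bdd_belowI[of T u])
  have "Inf T \<noteq> u" using Inf(1) H by (auto simp: T_def)
  then have u: "u < Inf T" "Inf T \<le> v" "c (Inf T) \<in> V" using Inf(1) by (auto simp: T_def)
  have "connected (c ` {u..<Inf T})"
    by (intro connected_continuous_image continuous_on_subset[OF c] connected_Ico) (use u in auto)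
  moreover have "c s \<notin> V" if s: "s \<in> {u..<Inf T}" for s
  proof
    assume "c s \<in> V"
    then have "s \<in> T" using s u(2) by (simp add: T_def)
    then show False using Inf(2) s by fastforce
  qed
  then have "c ` {u..<Inf T} \<inter> V = {}"
    unfolding disjoint_iff by (metis imageE)
  moreover have "c u \<in> c ` {u..<Inf T}" using u(1) by simp
  ultimately have "c ` {u..<Inf T} \<subseteq> H" by (rule connected_in_horoball[OF _ _ H])
  then show ?thesis using that u by blast
qed

lemma horoball_crossing:
  fixes c :: "real \<Rightarrow> 'x"
  assumes c: "continuous_on {0..l} c" and ends: "c 0 \<in> V" "c l \<in> V"
    and t: "0 \<le> t" "t \<le> l" and H: "H \<in> \<H>" "c t \<in> H"
  obtains u v where "0 \<le> u" "u < t" "t < v" "v \<le> l" "c u \<in> V" "c v \<in> V" "c ` {u<..<v} \<subseteq> H"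
proof -
  obtain v where v: "t < v" "v \<le> l" "c v \<in> V" "c ` {t..<v} \<subseteq> H"
    by (rule exit_horoball[OF continuous_on_subset[OF c] H ends(2) t(2)]) (use t in auto)
  \<comment> \<open>The entrance is found as the exit of the path run backwards.\<close>
  have "continuous_on {-t..0} (\<lambda>s. c (- s))"
    by (rule continuous_on_compose2[OF c]) (use t in \<open>auto intro!: continuous_intros\<close>)
  then obtain u where u: "-t < u" "u \<le> 0" "c (- u) \<in> V" "(\<lambda>s. c (- s)) ` {-t..<u} \<subseteq> H"
    using exit_horoball[of "-t" 0 "\<lambda>s. c (- s)" H] H ends t by auto
  have "c s \<in> H" if "s \<in> {-u<..<v}" for s
  proof (cases "t \<le> s")
    case True
    then show ?thesis using that v(4) by auto
  next
    case False
    then have "- s \<in> {-t..<u}" using that by auto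
    then have "c (- (- s)) \<in> H" using u(4) by blast
    then show ?thesis by simp
  qed
  then have "c ` {-u<..<v} \<subseteq> H" by blast
  then show ?thesis using u v by (intro that[of "-u" v]) simp_all
qed

lemma ball_in_horoball:
  assumes H: "H \<in> \<H>" "x \<in> H" and r: "\<And>z. dist x z < r \<Longrightarrow> z \<notin> V"
  shows "ball x r \<subseteq> H"
proof
  fix z assume z: "z \<in> ball x r"
  obtain c where c: "geodesic_path x z c" by (rule geodesic_path_exists)
  have "connected (c ` {0..dist x z})"
    by (intro connected_continuous_image geodesic_path_continuous[OF c]) simp
  moreover have "c ` {0..dist x z} \<inter> V = {}"
    using r z geodesic_path_dist_start[OF c] by fastforce
  moreover have "c 0 \<in> c ` {0..dist x z}" "c (dist x z) \<in> c ` {0..dist x z}" by auto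
  ultimately show "z \<in> H"
    using connected_in_horoball[OF _ _ H] geodesic_path_ends[OF c] by auto
qed

text \<open>For different horoballs, the points \<open>z\<close> are at distance at least 1 from each other.\<close>

lemma finite_deep_horoballs:
  assumes "compact C"
  shows "finite {H \<in> \<H>. \<exists>z\<in>C. ball z 1 \<subseteq> H}"
proof -
  obtain F where F: "finite F" "C \<subseteq> (\<Union>x\<in>F. ball x (1/2))"
    using assms[unfolded compact_eq_totally_bounded, THEN conjunct2, rule_format, of "1/2"] by auto
  let ?A = "{H \<in> \<H>. \<exists>z\<in>C. ball z 1 \<subseteq> H}"
  have "\<exists>p. p \<in> F \<and> (\<exists>z. ball z 1 \<subseteq> H \<and> dist p z < 1/2)" if H: "H \<in> ?A" for H
  proof -
    obtain z where z: "z \<in> C" "ball z 1 \<subseteq> H" using H by blast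
    then obtain p where "p \<in> F" "z \<in> ball p (1/2)" using F(2) by blast
    then show ?thesis using z by (intro exI[of _ p] conjI exI[of _ z]) simp_all
  qed
  then have "\<exists>p. \<forall>H\<in>?A. p H \<in> F \<and> (\<exists>z. ball z 1 \<subseteq> H \<and> dist (p H) z < 1/2)"
    by (intro bchoice ballI)
  then obtain p where p: "\<And>H. H \<in> ?A \<Longrightarrow> p H \<in> F"
    "\<And>H. H \<in> ?A \<Longrightarrow> \<exists>z. ball z 1 \<subseteq> H \<and> dist (p H) z < 1/2" by blast
  have "inj_on p ?A"
  proof (rule inj_onI)
    fix H H' assume H: "H \<in> ?A" "H' \<in> ?A" "p H = p H'"
    obtain z where z: "ball z 1 \<subseteq> H" "dist (p H) z < 1/2" using p(2)[OF H(1)] by blast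
    obtain z' where z': "ball z' 1 \<subseteq> H'" "dist (p H) z' < 1/2" using p(2)[OF H(2)] H(3) by auto
    have "dist z z' < 1" using z z' dist_triangle_half_r by blast
    then have "z' \<in> H" "z' \<in> H'" using z(1) z'(1) by auto
    then show "H = H'" using H horoball_eqI by blast
  qed
  moreover have "p ` ?A \<subseteq> F" using p(1) by blast
  ultimately show ?thesis using F(1) finite_imageD finite_subset by blast
qed

text \<open>Cocompactness only controls points near \<open>V\<close>, so a deep point is needed that
  is not too deep: on a geodesic from the centre of a unit ball in \<open>H\<close> to
  \<open>x0\<close>, some point inside \<open>H\<close> has distance exactly 1 from
  \<open>V\<close>. A translation carries a point of \<open>V\<close> at distance less than 2 from
  it into \<open>K\<close>, and only finitely many horoballs have a deep point in a fixed
  ball.\<close>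

lemma finitely_many_horoball_orbits:
  "\<exists>\<F>. finite \<F> \<and> \<F> \<subseteq> \<H> \<and> (\<forall>H\<in>\<H>. \<exists>g\<in>carrier G. \<phi> g ` H \<in> \<F>)"
proof -
  obtain K where K: "compact K" "V = (\<Union>g\<in>carrier G. \<phi> g ` K)" using cocompact by (elim exE conjE) (rule that)
  obtain r where r: "\<And>k. k \<in> K \<Longrightarrow> dist x0 k \<le> r"
    using compact_imp_bounded[OF K(1)] by (metis bounded_any_center)
  let ?F = "{H \<in> \<H>. \<exists>z\<in>cball x0 (r + 2). ball z 1 \<subseteq> H}"
  have "\<exists>g\<in>carrier G. \<phi> g ` H \<in> ?F" if H: "H \<in> \<H>" for H
  proof -
    obtain p where p: "cball p 1 \<subseteq> H"
      using horoball_contains_ball[OF proper] horoballs[OF H] by blast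
    then have pH: "p \<in> H" by auto
    obtain c where c: "geodesic_path p x0 c" by (rule geodesic_path_exists)
    note cont = geodesic_path_continuous[OF c] and ce = geodesic_path_ends[OF c]
    obtain v where v: "0 < v" "v \<le> dist p x0" "c v \<in> V" "c ` {0..<v} \<subseteq> H"
      by (rule exit_horoball[OF cont H]) (use ce pH basepoint_V in auto)
    define f where "f t = infdist (c t) V" for t
    have Vne: "V \<noteq> {}" using basepoint_V by blast
    have "1 \<le> f 0"
    proof (rule ccontr)
      assume "\<not> 1 \<le> f 0"
      then obtain z where "z \<in> V" "dist p z < 1"
        using infdist_less_obtain[OF Vne, of p 1] ce by (auto simp: f_def)
      then show False using p H by (auto simp: subset_iff)
    qed
    moreover have "f v = 0" using v(3) by (simp add: f_def)
    moreover have "continuous_on {0..v} f"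
      unfolding f_def by (intro continuous_on_infdist continuous_on_subset[OF cont]) (use v in auto)
    ultimately obtain t where t: "0 \<le> t" "t \<le> v" "f t = 1"
      using IVT2'[of f v 1 0] v(1) by auto
    then have "t \<noteq> v" using \<open>f v = 0\<close> by auto
    then have ct: "c t \<in> H" using t v(4) by auto
    have "z \<notin> V" if "dist (c t) z < 1" for z
    proof
      assume "z \<in> V"
      from infdist_le[OF this, of "c t"] that t(3) show False by (simp add: f_def)
    qed
    then have b: "ball (c t) 1 \<subseteq> H" by (intro ball_in_horoball[OF H ct])
    obtain z where z: "z \<in> V" "dist (c t) z < 2"
      using infdist_less_obtain[OF Vne, of "c t" 2] t(3) by (auto simp: f_def)
    then obtain g k where gk: "g \<in> carrier G" "k \<in> K" "z = \<phi> g k" unfolding K(2) by blast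
    let ?g = "inv g"
    have g: "?g \<in> carrier G" using gk by simp
    have "dist (\<phi> ?g (c t)) k < 2"
      using z isometric[OF g, of "c t" z] gk by (simp add: act_inv)
    then have "\<phi> ?g (c t) \<in> cball x0 (r + 2)"
      using r[OF gk(2)] dist_triangle[of x0 "\<phi> ?g (c t)" k] by (simp add: dist_commute)
    moreover have "ball (\<phi> ?g (c t)) 1 \<subseteq> \<phi> ?g ` H"
    proof
      fix y assume "y \<in> ball (\<phi> ?g (c t)) 1"
      then have "dist (c t) (\<phi> g y) < 1" using act_dist_inv[OF g, of "c t" y] gk(1) by simp
      then have "\<phi> g y \<in> H" using b by auto
      then show "y \<in> \<phi> ?g ` H" using act_inv(1)[OF gk(1), of y] by (metis image_eqI)
    qed
    moreover have "\<phi> ?g ` H \<in> \<H>" using equivariant[OF g H] .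
    ultimately show ?thesis using g by blast
  qed
  moreover have "finite ?F" by (rule finite_deep_horoballs[OF compact_cball])
  ultimately show ?thesis by (intro exI[of _ ?F]) blast
qed

text \<open>\<open>horoball_deep_midpoint\<close> gives one constant per horoball. The property
  survives enlarging the constant and translating by \<open>G\<close>, so a common bound for the
  finitely many orbit representatives serves every horoball.\<close>

lemma deep_midpoint_uniform:
  obtains L where "0 \<le> L"
    "\<And>H x y S m z. \<lbrakk>H \<in> \<H>; x \<in> H; y \<in> H; geodesic_segment x y S; m \<in> S;
       L \<le> dist x m; L \<le> dist m y; dist m z \<le> \<kappa>\<rbrakk> \<Longrightarrow> z \<in> H"
proof -
  define T where "T H L \<longleftrightarrow> (\<forall>x y S m z. x \<in> H \<longrightarrow> y \<in> H \<longrightarrow> geodesic_segment x y S \<longrightarrow> m \<in> S \<longrightarrow>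
    L \<le> dist x m \<longrightarrow> L \<le> dist m y \<longrightarrow> dist m z \<le> \<kappa> \<longrightarrow> z \<in> H)" for H :: "'x set" and L
  have mono: "T H L'" if "T H L" "L \<le> L'" for H L L'
    using that unfolding T_def by (meson order_trans)
  obtain \<F> where F: "finite \<F>" "\<F> \<subseteq> \<H>" "\<forall>H\<in>\<H>. \<exists>g\<in>carrier G. \<phi> g ` H \<in> \<F>"
    using finitely_many_horoball_orbits by blast
  have "\<exists>L. T H L" if "H \<in> \<F>" for H
    unfolding T_def using that F(2) horoballs by (intro horoball_deep_midpoint[OF proper]) blast
  then obtain \<Lambda> where \<Lambda>: "\<And>H. H \<in> \<F> \<Longrightarrow> T H (\<Lambda> H)" by metis
  define L where "L = (\<Sum>H\<in>\<F>. \<bar>\<Lambda> H\<bar>)"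
  have L: "T H L" if "H \<in> \<F>" for H
  proof (rule mono[OF \<Lambda>[OF that]])
    have "\<bar>\<Lambda> H\<bar> \<le> L" unfolding L_def using F(1) that by (intro member_le_sum) auto
    then show "\<Lambda> H \<le> L" by linarith
  qed
  have "0 \<le> L" unfolding L_def by (intro sum_nonneg) simp
  then show ?thesis
  proof (rule that)
    fix H x y S m z
    assume H: "H \<in> \<H>" and a: "x \<in> H" "y \<in> H" "geodesic_segment x y S" "m \<in> S"
      "L \<le> dist x m" "L \<le> dist m y" "dist m z \<le> \<kappa>"
    obtain g where g: "g \<in> carrier G" "\<phi> g ` H \<in> \<F>" using F(3) H by blast
    have "\<phi> g z \<in> \<phi> g ` H"
      by (rule L[OF g(2), unfolded T_def, rule_format, of "\<phi> g x" "\<phi> g y" "\<phi> g ` S" "\<phi> g m"])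
        (use a isometric[OF g(1)] geodesic_segment_isometry[OF isometric[OF g(1)] a(3)] in simp_all)
    then show "z \<in> H" using act_image_iff[OF g(1)] by blast
  qed
qed

text \<open>Otherwise the geodesic stays in one horoball \<open>H\<close> for longer than
  \<open>L + 1\<close> before and after \<open>t\<close>, and \<open>deep_midpoint_uniform\<close>
  puts everything within \<open>\<kappa>\<close> of \<open>c t\<close> into \<open>H\<close>,
  including the point \<open>z\<close> of \<open>V\<close>. The extra 1 keeps \<open>t - L\<close>
  and \<open>t + L\<close> strictly inside the crossing, even for \<open>L = 0\<close>.\<close>

lemma return_to_V:
  obtains L where "0 \<le> L"
    "\<And>x y c t z. \<lbrakk>x \<in> V; y \<in> V; geodesic_path x y c; t \<in> {0..dist x y}; z \<in> V; dist (c t) z \<le> \<kappa>\<rbrakk>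
       \<Longrightarrow> \<exists>t'\<in>{0..dist x y}. \<bar>t' - t\<bar> \<le> L \<and> c t' \<in> V"
proof -
  obtain L where L: "0 \<le> L" "\<And>H x y S m z. \<lbrakk>H \<in> \<H>; x \<in> H; y \<in> H; geodesic_segment x y S; m \<in> S;
       L \<le> dist x m; L \<le> dist m y; dist m z \<le> \<kappa>\<rbrakk> \<Longrightarrow> z \<in> H"
    by (rule deep_midpoint_uniform[of \<kappa>], rule that)
  have "0 \<le> L + 1" using L(1) by simp
  then show ?thesis
  proof (rule that)
    fix x y c t z
    assume V: "x \<in> V" "y \<in> V" "z \<in> V" and c: "geodesic_path x y c" and t: "t \<in> {0..dist x y}"
      and d: "dist (c t) z \<le> \<kappa>"
    show "\<exists>t'\<in>{0..dist x y}. \<bar>t' - t\<bar> \<le> L + 1 \<and> c t' \<in> V"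
    proof (cases "c t \<in> V")
      case True
      then show ?thesis using t L(1) by (intro bexI[of _ t]) auto
    next
      case False
      then obtain H where H: "H \<in> \<H>" "c t \<in> H" by blast
      have ends: "c 0 \<in> V" "c (dist x y) \<in> V" using V geodesic_path_ends[OF c] by simp_all
      obtain u v where uv: "0 \<le> u" "u < t" "t < v" "v \<le> dist x y" "c u \<in> V" "c v \<in> V" "c ` {u<..<v} \<subseteq> H"
        by (rule horoball_crossing[OF geodesic_path_continuous[OF c] ends _ _ H]) (use t in auto)
      show ?thesis
      proof (rule ccontr)
        assume "\<not> ?thesis"
        then have n: "\<not> \<bar>t' - t\<bar> \<le> L + 1" if "t' \<in> {0..dist x y}" "c t' \<in> V" for t'
          using that by blast
        have ut: "L + 1 < t - u" using n[OF _ uv(5)] uv t by auto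
        have tv: "L + 1 < v - t" using n[OF _ uv(6)] uv t by auto
        have "t - L \<in> {u<..<v}" "t + L \<in> {u<..<v}" using ut tv L(1) by auto
        then have cH: "c (t - L) \<in> H" "c (t + L) \<in> H" using uv(7) by blast+
        have seg: "geodesic_segment (c (t - L)) (c (t + L)) (c ` {t - L..t + L})"
          by (rule geodesic_segment_sub[OF c]) (use ut tv uv L(1) in auto)
        have mem: "c t \<in> c ` {t - L..t + L}" using L(1) by auto
        have eq: "dist (c (t - L)) (c t) = L" "dist (c t) (c (t + L)) = L"
          using geodesic_path_dist[OF c, of "t - L" t] geodesic_path_dist[OF c, of t "t + L"]
            ut tv uv t L(1) by auto
        have "z \<in> H" by (rule L(2)[OF H(1) cH seg mem _ _ d]) (simp_all add: eq)
        then show False using V(3) H(1) by blast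
      qed
    qed
  qed
qed

end

section \<open>The Gromov product of two quasiconvex orbits\<close>

context slim_space
begin

text \<open>Since the product of \<open>\<alpha> \<tau>\<close> with \<open>x\<close> is
  \<open>\<tau>\<close>, the four-point inequality bounds the product of
  \<open>\<alpha> \<tau>\<close> with \<open>y\<close> from below, hence the distance from
  \<open>\<alpha> \<tau>\<close> to \<open>y\<close> from above. The minimum allows
  \<open>\<tau>\<close> to exceed the Gromov product, as it does at the exit from a
  horoball.\<close>

lemma detour_length:
  assumes \<alpha>: "geodesic_path (w::'x) x \<alpha>" and \<tau>: "\<tau> \<in> {0..dist w x}" and p: "dist p (\<alpha> \<tau>) \<le> K"
  shows "dist p x + dist p y \<le> dist w x + dist w y - 2 * min (gromov_product w x y) \<tau> + 2 * K + 2 * (3 * \<delta> + 2)"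
proof -
  have "gromov_product w (\<alpha> \<tau>) x = \<tau>"
    using geodesic_path_dist_start[OF \<alpha> \<tau>] geodesic_path_dist_end[OF \<alpha> \<tau>]
    by (simp add: gromov_product_def)
  then have "min \<tau> (gromov_product w x y) \<le> gromov_product w (\<alpha> \<tau>) y + (3 * \<delta> + 2)"
    using four_point[of w "\<alpha> \<tau>" x y] by simp
  moreover have "2 * gromov_product w (\<alpha> \<tau>) y = \<tau> + dist w y - dist (\<alpha> \<tau>) y"
    using geodesic_path_dist_start[OF \<alpha> \<tau>] by (simp add: gromov_product_def)
  ultimately show ?thesis
    using geodesic_path_dist_end[OF \<alpha> \<tau>] p dist_triangle[of p x "\<alpha> \<tau>"] dist_triangle[of p y "\<alpha> \<tau>"]
    by (simp add: min.commute)
qed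

end

text \<open>Uniform constants are extracted from finiteness in this way: choose one witness for each
  \<open>s\<close> and add up the values. Without a witness \<open>Eps (P s)\<close> is arbitrary;
  the absolute values keep the sum an upper bound.\<close>

lemma finite_bounded_witness:
  fixes f :: "'b \<Rightarrow> real"
  assumes "finite S"
  obtains N where "\<And>s w. s \<in> S \<Longrightarrow> P s w \<Longrightarrow> \<exists>w'. P s w' \<and> f w' \<le> N"
proof
  fix s w assume s: "s \<in> S" "P s w"
  have "f (Eps (P s)) \<le> \<bar>f (Eps (P s))\<bar>" by simp
  also have "\<dots> \<le> (\<Sum>s\<in>S. \<bar>f (Eps (P s))\<bar>)" using assms s by (intro member_le_sum) auto
  finally show "\<exists>w'. P s w' \<and> f w' \<le> (\<Sum>s\<in>S. \<bar>f (Eps (P s))\<bar>)" using someI[of "P s"] s by blast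
qed

section \<open>Orbits of quasiconvex subgroups, outside and inside the horoballs\<close>

context relatively_hyperbolic
begin

abbreviation orb :: "'a \<Rightarrow> 'x" where "orb g \<equiv> \<phi> g x0"

lemma dist_orb: "a \<in> carrier G \<Longrightarrow> b \<in> carrier G \<Longrightarrow> dist (orb a) (orb b) = dist x0 (orb (inv a \<otimes> b))"
  by (simp add: act_mult act_dist_inv)

lemma dist_orb_mult: "a \<in> carrier G \<Longrightarrow> b \<in> carrier G \<Longrightarrow> dist (orb a) (orb (a \<otimes> b)) = dist x0 (orb b)"
  by (simp add: act_mult isometric)

lemma dist_orb_inv: "a \<in> carrier G \<Longrightarrow> dist x0 (orb (inv a)) = dist x0 (orb a)"
  using act_dist_inv[of "inv a" x0 x0] by (simp add: dist_commute)

lemma orb_V: "a \<in> carrier G \<Longrightarrow> orb a \<in> V"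
  by (rule act_V[OF _ basepoint_V])

lemma relatively_quasiconvexD:
  assumes Q: "subgroup Q G" and qc: "relatively_quasiconvex \<phi> \<H> x0 Q"
  obtains \<mu> where "0 \<le> \<mu>"
    "\<And>a c t. \<lbrakk>a \<in> Q; geodesic_path x0 (orb a) c; t \<in> {0..dist x0 (orb a)}; c t \<in> V\<rbrakk>
       \<Longrightarrow> \<exists>q\<in>Q. dist (c t) (orb q) \<le> \<mu>"
proof -
  obtain \<mu> where \<mu>: "0 \<le> \<mu>" "\<forall>q1\<in>Q. \<forall>q2\<in>Q. \<forall>S. geodesic_segment (\<phi> q1 x0) (\<phi> q2 x0) S \<longrightarrow>
        (\<forall>p\<in>S - \<Union>\<H>. \<exists>q\<in>Q. dist p (\<phi> q x0) \<le> \<mu>)"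
    using qc unfolding relatively_quasiconvex_def by (elim exE conjE) (rule that)
  show ?thesis
  proof (rule that[OF \<mu>(1)])
    fix a c t
    assume a: "a \<in> Q" "geodesic_path x0 (orb a) c" "t \<in> {0..dist x0 (orb a)}" "c t \<in> V"
    have "geodesic_segment (orb \<one>) (orb a) (c ` {0..dist x0 (orb a)})"
      using geodesic_path_segment[OF a(2)] by (simp add: act_one)
    moreover have "c t \<in> c ` {0..dist x0 (orb a)} - \<Union>\<H>"
      using a(3,4) by (intro DiffI imageI) simp_all
    ultimately show "\<exists>q\<in>Q. dist (c t) (orb q) \<le> \<mu>"
      by (rule \<mu>(2)[rule_format, OF subgroup.one_closed[OF Q] a(1)])
  qed
qed

text \<open>Two pairs with the same quotient \<open>inv a \<otimes> b\<close> satisfy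
  \<open>a \<otimes> inv a' = b \<otimes> inv b'\<close>, an element of \<open>Q \<inter> R\<close>.
  Only finitely many quotients have displacement at most \<open>\<kappa>\<close>, so
  \<open>a'\<close> can be taken of bounded displacement.\<close>

lemma neighbourhood_intersection:
  assumes Q: "subgroup Q G" and R: "subgroup R G"
  obtains \<kappa>' where "\<And>a b. \<lbrakk>a \<in> Q; b \<in> R; dist (orb a) (orb b) \<le> \<kappa>\<rbrakk>
     \<Longrightarrow> \<exists>c\<in>Q \<inter> R. dist (orb a) (orb c) \<le> \<kappa>'"
proof -
  define P where "P g ab \<longleftrightarrow> fst ab \<in> Q \<and> snd ab \<in> R \<and> inv (fst ab) \<otimes> snd ab = g" for g ab
  obtain N where N: "\<And>g ab. g \<in> {g \<in> carrier G. dist x0 (orb g) \<le> \<kappa>} \<Longrightarrow> P g ab \<Longrightarrow>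
      \<exists>ab'. P g ab' \<and> dist x0 (orb (fst ab')) \<le> N"
    by (rule finite_bounded_witness[OF finite_short_elements, of \<kappa> P "\<lambda>ab. dist x0 (orb (fst ab))"], rule that)
  show ?thesis
  proof (rule that)
    fix a b assume ab: "a \<in> Q" "b \<in> R" "dist (orb a) (orb b) \<le> \<kappa>"
    have carr: "a \<in> carrier G" "b \<in> carrier G" using ab subgroup.mem_carrier[OF Q] subgroup.mem_carrier[OF R] by auto
    have "P (inv a \<otimes> b) (a, b)" using ab by (simp add: P_def)
    moreover have "inv a \<otimes> b \<in> {g \<in> carrier G. dist x0 (orb g) \<le> \<kappa>}"
      using ab dist_orb[OF carr] carr by simp
    ultimately obtain a' b' where ab': "a' \<in> Q" "b' \<in> R" "inv a' \<otimes> b' = inv a \<otimes> b" "dist x0 (orb a') \<le> N"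
      using N unfolding P_def by fastforce
    have carr': "a' \<in> carrier G" "b' \<in> carrier G" using ab' subgroup.mem_carrier[OF Q] subgroup.mem_carrier[OF R] by auto
    have "b' = a' \<otimes> (inv a \<otimes> b)" using ab'(3) carr carr' by (metis inv_closed inv_solve_left' m_closed)
    then have "a \<otimes> inv a' = b \<otimes> inv b'"
      using carr carr' by (simp add: inv_mult_group m_assoc[symmetric])
    moreover have "a \<otimes> inv a' \<in> Q" "b \<otimes> inv b' \<in> R"
      using ab ab' subgroup.m_closed[OF Q] subgroup.m_inv_closed[OF Q]
        subgroup.m_closed[OF R] subgroup.m_inv_closed[OF R] by auto
    ultimately have "a \<otimes> inv a' \<in> Q \<inter> R" by simp
    moreover have "dist (orb a) (orb (a \<otimes> inv a')) \<le> N"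
      using ab'(4) carr carr' by (simp add: dist_orb_mult dist_orb_inv)
    ultimately show "\<exists>c\<in>Q \<inter> R. dist (orb a) (orb c) \<le> N" by blast
  qed
qed

text \<open>The unit ball is what makes \<open>finite_deep_horoballs\<close> apply: only finitely
  many horoballs are \<open>near_deep\<close> at a given point.\<close>

definition near_deep :: "real \<Rightarrow> 'x set \<Rightarrow> 'x \<Rightarrow> bool" where
  "near_deep K H y \<longleftrightarrow> (\<exists>z. dist y z \<le> K \<and> ball z 1 \<subseteq> H)"

lemma near_deep_mono: "near_deep K H y \<Longrightarrow> K \<le> K' \<Longrightarrow> near_deep K' H y"
  unfolding near_deep_def by (meson order_trans)

lemma near_deep_act:
  assumes g: "g \<in> carrier G" and d: "near_deep K H y"
  shows "near_deep K (\<phi> g ` H) (\<phi> g y)"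
proof -
  obtain z where z: "dist y z \<le> K" "ball z 1 \<subseteq> H" using d by (auto simp: near_deep_def)
  have "ball (\<phi> g z) 1 \<subseteq> \<phi> g ` H"
  proof
    fix p assume "p \<in> ball (\<phi> g z) 1"
    then have "\<phi> (inv g) p \<in> H" using z(2) act_dist_inv[OF g, of z p] by auto
    then show "p \<in> \<phi> g ` H" using act_inv(2)[OF g, of p] by (metis image_eqI)
  qed
  then show ?thesis
    unfolding near_deep_def using z(1) isometric[OF g] by (intro exI[of _ "\<phi> g z"]) simp
qed

text \<open>There are finitely many pairs of horoballs with deep points near \<open>x0\<close>, hence finitely many
  elements \<open>u\<close> of \<open>Q\<close> suffice to carry \<open>inv a ` H\<close> to \<open>inv c ` H\<close>; then \<open>p = a \<otimes> inv u \<otimes> inv c\<close>.\<close>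

lemma parabolic_transport:
  assumes Q: "subgroup Q G"
  obtains N where "\<And>H c a. \<lbrakk>H \<in> \<H>; c \<in> Q; a \<in> Q; near_deep K H (orb c); near_deep K H (orb a)\<rbrakk>
     \<Longrightarrow> \<exists>p\<in>Q. \<phi> p ` H = H \<and> dist (orb (p \<otimes> c)) (orb a) \<le> N"
proof -
  define F where "F = {H \<in> \<H>. near_deep K H x0}"
  define P where "P HH u \<longleftrightarrow> u \<in> Q \<and> \<phi> u ` fst HH = snd HH" for HH u
  have F: "finite (F \<times> F)"
    using finite_deep_horoballs[OF compact_cball[of x0 K]] by (simp add: F_def near_deep_def mem_cball Bex_def)
  obtain N where N: "\<And>HH u. HH \<in> F \<times> F \<Longrightarrow> P HH u \<Longrightarrow> \<exists>u'. P HH u' \<and> dist x0 (orb u') \<le> N"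
    by (rule finite_bounded_witness[OF F, of P "\<lambda>u. dist x0 (orb u)"], rule that)
  show ?thesis
  proof (rule that)
    fix H c a assume H: "H \<in> \<H>" and ca: "c \<in> Q" "a \<in> Q" and d: "near_deep K H (orb c)" "near_deep K H (orb a)"
    have carr: "c \<in> carrier G" "a \<in> carrier G" using ca subgroup.mem_carrier[OF Q] by auto
    let ?H1 = "\<phi> (inv a) ` H" and ?H2 = "\<phi> (inv c) ` H"
    have "?H1 \<in> F" "?H2 \<in> F"
      using near_deep_act[of "inv a", OF _ d(2)] near_deep_act[of "inv c", OF _ d(1)]
        equivariant[of "inv a", OF _ H] equivariant[of "inv c", OF _ H] carr
      by (simp_all add: F_def act_inv)
    \<comment> \<open>\<open>inv c \<otimes> a\<close> is a witness of uncontrolled displacement;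
      the bounded \<open>u\<close> carries the first of these two horoballs to the second as
      well.\<close>
    moreover have "P (?H1, ?H2) (inv c \<otimes> a)"
    proof -
      have "\<phi> (inv c \<otimes> a) ` ?H1 = ?H2"
        using carr by (simp add: act_image_mult[symmetric] m_assoc)
      then show ?thesis using ca subgroup.m_closed[OF Q] subgroup.m_inv_closed[OF Q] by (simp add: P_def)
    qed
    ultimately obtain u where u: "u \<in> Q" "\<phi> u ` ?H1 = ?H2" "dist x0 (orb u) \<le> N"
      using N[of "(?H1, ?H2)" "inv c \<otimes> a"] by (auto simp: P_def)
    have uc: "u \<in> carrier G" using u subgroup.mem_carrier[OF Q] by auto
    define p where "p = a \<otimes> inv u \<otimes> inv c"
    have p: "p \<in> Q" using ca u subgroup.m_closed[OF Q] subgroup.m_inv_closed[OF Q] by (simp add: p_def)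
    have "\<phi> p ` H = \<phi> (a \<otimes> inv u) ` ?H2" using carr uc by (simp add: p_def act_image_mult)
    also have "\<dots> = \<phi> (a \<otimes> inv u) ` \<phi> (u \<otimes> inv a) ` H"
      using u(2) carr uc by (simp add: act_image_mult)
    also have "\<dots> = \<phi> (a \<otimes> inv u \<otimes> (u \<otimes> inv a)) ` H"
      using carr uc by (intro act_image_mult[symmetric]) simp_all
    also have "a \<otimes> inv u \<otimes> (u \<otimes> inv a) = \<one>"
      using carr uc by (metis inv_closed inv_inv inv_mult_group m_closed r_inv)
    finally have pH: "\<phi> p ` H = H" by (simp add: act_image_one)
    have "p \<otimes> c = a \<otimes> inv u" using carr uc by (simp add: p_def m_assoc)
    then have "dist (orb (p \<otimes> c)) (orb a) \<le> N"
      using u(3) carr uc by (simp add: dist_commute[of _ "orb a"] dist_orb_mult dist_orb_inv)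
    then show "\<exists>p\<in>Q. \<phi> p ` H = H \<and> dist (orb (p \<otimes> c)) (orb a) \<le> N" using p pH by blast
  qed
qed

lemma crossing_deep:
  obtains L where "0 \<le> L"
    "\<And>H x y c u v m. \<lbrakk>H \<in> \<H>; geodesic_path x y c; 0 \<le> u; v \<le> dist x y; c ` {u<..<v} \<subseteq> H;
       u + L < m; m < v - L\<rbrakk> \<Longrightarrow> ball (c m) 1 \<subseteq> H"
proof -
  obtain L where L: "0 \<le> L" "\<And>H x y S m z. \<lbrakk>H \<in> \<H>; x \<in> H; y \<in> H; geodesic_segment x y S; m \<in> S;
       L \<le> dist x m; L \<le> dist m y; dist m z \<le> 1\<rbrakk> \<Longrightarrow> z \<in> H"
    by (rule deep_midpoint_uniform[of 1], rule that)
  show ?thesis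
  proof (rule that[OF L(1)], rule subsetI)
    fix H x y c u v m z
    assume H: "H \<in> \<H>" and c: "geodesic_path x y c" and uv: "0 \<le> u" "v \<le> dist x y" "c ` {u<..<v} \<subseteq> H"
      and m: "u + L < m" "m < v - L" and z: "z \<in> ball (c m) 1"
    have "m - L \<in> {u<..<v}" "m + L \<in> {u<..<v}" using m L(1) by auto
    then have cH: "c (m - L) \<in> H" "c (m + L) \<in> H" using uv(3) by blast+
    have seg: "geodesic_segment (c (m - L)) (c (m + L)) (c ` {m - L..m + L})"
      by (rule geodesic_segment_sub[OF c]) (use m uv L(1) in auto)
    have mem: "c m \<in> c ` {m - L..m + L}" using L(1) by auto
    have eq: "dist (c (m - L)) (c m) = L" "dist (c m) (c (m + L)) = L"
      using geodesic_path_dist[OF c, of "m - L" m] geodesic_path_dist[OF c, of m "m + L"] m uv L(1) by auto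
    show "z \<in> H" by (rule L(2)[OF H cH seg mem]) (use z in \<open>simp_all add: eq\<close>)
  qed
qed

text \<open>The exit lies in \<open>V\<close>, so some \<open>orb q\<close> with \<open>q\<close> in
  \<open>Q\<close> is close to it, and a point of the geodesic slightly before the exit is deep in
  \<open>H\<close>. Thus \<open>orb c\<close> and \<open>orb q\<close> are both
  \<open>near_deep\<close>, and \<open>parabolic_transport\<close> applies.\<close>

lemma parabolic_exit:
  assumes Q: "subgroup Q G" and qc: "relatively_quasiconvex \<phi> \<H> x0 Q"
  obtains L N where "0 \<le> L"
    "\<And>a \<alpha> u v H c. \<lbrakk>a \<in> Q; geodesic_path x0 (orb a) \<alpha>; 0 \<le> u; u + L < v; v \<le> dist x0 (orb a); \<alpha> v \<in> V;
       \<alpha> ` {u<..<v} \<subseteq> H; H \<in> \<H>; c \<in> Q; near_deep K H (orb c)\<rbrakk>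
     \<Longrightarrow> \<exists>p\<in>Q. \<phi> p ` H = H \<and> dist (orb (p \<otimes> c)) (\<alpha> v) \<le> N"
proof -
  obtain L where L: "0 \<le> L" "\<And>H x y c u v m. \<lbrakk>H \<in> \<H>; geodesic_path x y c; 0 \<le> u; v \<le> dist x y;
      c ` {u<..<v} \<subseteq> H; u + L < m; m < v - L\<rbrakk> \<Longrightarrow> ball (c m) 1 \<subseteq> H"
    by (rule crossing_deep, rule that)
  obtain \<mu> where \<mu>: "0 \<le> \<mu>" "\<And>a c t. \<lbrakk>a \<in> Q; geodesic_path x0 (orb a) c; t \<in> {0..dist x0 (orb a)}; c t \<in> V\<rbrakk>
       \<Longrightarrow> \<exists>q\<in>Q. dist (c t) (orb q) \<le> \<mu>"
    by (rule relatively_quasiconvexD[OF Q qc], rule that)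
  obtain N where N: "\<And>H c a. \<lbrakk>H \<in> \<H>; c \<in> Q; a \<in> Q; near_deep (max K (\<mu> + L + 1)) H (orb c);
       near_deep (max K (\<mu> + L + 1)) H (orb a)\<rbrakk>
     \<Longrightarrow> \<exists>p\<in>Q. \<phi> p ` H = H \<and> dist (orb (p \<otimes> c)) (orb a) \<le> N"
    by (rule parabolic_transport[OF Q], rule that)
  \<comment> \<open>A crossing of this length leaves the time \<open>v - L - 1\<close> more than
    \<open>L\<close> away from both \<open>u\<close> and \<open>v\<close>.\<close>
  have "0 \<le> 2 * L + 2" using L(1) by simp
  then show ?thesis
  proof (rule that)
    fix a \<alpha> u v H c
    assume a: "a \<in> Q" and \<alpha>: "geodesic_path x0 (orb a) \<alpha>" and uv: "0 \<le> u" "u + (2 * L + 2) < v" "v \<le> dist x0 (orb a)"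
      and v: "\<alpha> v \<in> V" and sub: "\<alpha> ` {u<..<v} \<subseteq> H" and H: "H \<in> \<H>" and c: "c \<in> Q" "near_deep K H (orb c)"
    have vi: "v \<in> {0..dist x0 (orb a)}" "v - L - 1 \<in> {0..dist x0 (orb a)}" using uv L(1) by auto
    obtain q where q: "q \<in> Q" "dist (\<alpha> v) (orb q) \<le> \<mu>" using \<mu>(2)[OF a \<alpha> vi(1) v] by blast
    have "ball (\<alpha> (v - L - 1)) 1 \<subseteq> H"
      by (rule L(2)[OF H \<alpha> uv(1) uv(3) sub]) (use uv in auto)
    moreover have "dist (\<alpha> v) (\<alpha> (v - L - 1)) = L + 1" using geodesic_path_dist[OF \<alpha> vi] L(1) by simp
    then have "dist (orb q) (\<alpha> (v - L - 1)) \<le> \<mu> + L + 1"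
      using q(2) dist_triangle[of "orb q" "\<alpha> (v - L - 1)" "\<alpha> v"] by (simp add: dist_commute)
    ultimately have "near_deep (max K (\<mu> + L + 1)) H (orb q)"
      using near_deep_mono[of "\<mu> + L + 1" H "orb q" "max K (\<mu> + L + 1)"] by (auto simp: near_deep_def)
    moreover have "near_deep (max K (\<mu> + L + 1)) H (orb c)" using c(2) by (rule near_deep_mono) simp
    ultimately obtain p where p: "p \<in> Q" "\<phi> p ` H = H" "dist (orb (p \<otimes> c)) (orb q) \<le> N"
      using N[OF H c(1) q(1)] by blast
    have "dist (orb (p \<otimes> c)) (\<alpha> v) \<le> N + \<mu>"
      using p(3) q(2) dist_triangle[of "orb (p \<otimes> c)" "\<alpha> v" "orb q"] by (simp add: dist_commute)
    then show "\<exists>p\<in>Q. \<phi> p ` H = H \<and> dist (orb (p \<otimes> c)) (\<alpha> v) \<le> N + \<mu>" using p by blast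
  qed
qed

text \<open>If \<open>\<alpha> s\<close> is near \<open>V\<close>, so is \<open>\<beta> s\<close> by
  fellow travelling. Both geodesics then visit \<open>V\<close> within time \<open>L\<close> of
  \<open>s\<close>, where quasiconvexity gives orbit points of \<open>Q\<close> and of
  \<open>R\<close>; these are close to each other, so \<open>neighbourhood_intersection\<close>
  applies.\<close>

lemma near_intersection:
  assumes Q: "subgroup Q G" "relatively_quasiconvex \<phi> \<H> x0 Q"
    and R: "subgroup R G" "relatively_quasiconvex \<phi> \<H> x0 R"
  obtains K where
    "\<And>a b \<alpha> \<beta> s z. \<lbrakk>a \<in> Q; b \<in> R; geodesic_path x0 (orb a) \<alpha>; geodesic_path x0 (orb b) \<beta>;
       0 \<le> s; s \<le> gromov_product x0 (orb a) (orb b); z \<in> V; dist (\<alpha> s) z \<le> \<kappa>\<rbrakk>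
     \<Longrightarrow> \<exists>c\<in>Q \<inter> R. dist (orb c) (\<alpha> s) \<le> K"
proof -
  define \<kappa>0 where "\<kappa>0 = 4 * (3 * slim_constant + 2)"
  obtain \<mu> where \<mu>: "0 \<le> \<mu>" "\<And>a c t. \<lbrakk>a \<in> Q; geodesic_path x0 (orb a) c; t \<in> {0..dist x0 (orb a)}; c t \<in> V\<rbrakk>
       \<Longrightarrow> \<exists>q\<in>Q. dist (c t) (orb q) \<le> \<mu>"
    by (rule relatively_quasiconvexD[OF Q], rule that)
  obtain \<nu> where \<nu>: "0 \<le> \<nu>" "\<And>a c t. \<lbrakk>a \<in> R; geodesic_path x0 (orb a) c; t \<in> {0..dist x0 (orb a)}; c t \<in> V\<rbrakk>
       \<Longrightarrow> \<exists>q\<in>R. dist (c t) (orb q) \<le> \<nu>"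
    by (rule relatively_quasiconvexD[OF R], rule that)
  obtain L where L: "0 \<le> L"
    "\<And>x y c t z. \<lbrakk>x \<in> V; y \<in> V; geodesic_path x y c; t \<in> {0..dist x y}; z \<in> V; dist (c t) z \<le> \<kappa> + \<kappa>0\<rbrakk>
       \<Longrightarrow> \<exists>t'\<in>{0..dist x y}. \<bar>t' - t\<bar> \<le> L \<and> c t' \<in> V"
    by (rule return_to_V[of "\<kappa> + \<kappa>0"], rule that)
  obtain \<kappa>' where \<kappa>': "\<And>a b. \<lbrakk>a \<in> Q; b \<in> R; dist (orb a) (orb b) \<le> \<mu> + L + \<kappa>0 + L + \<nu>\<rbrakk>
     \<Longrightarrow> \<exists>c\<in>Q \<inter> R. dist (orb a) (orb c) \<le> \<kappa>'"
    by (rule neighbourhood_intersection[OF Q(1) R(1)], rule that)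
  show ?thesis
  proof (rule that)
    fix a b \<alpha> \<beta> s z
    assume a: "a \<in> Q" "geodesic_path x0 (orb a) \<alpha>" and b: "b \<in> R" "geodesic_path x0 (orb b) \<beta>"
      and s: "0 \<le> s" "s \<le> gromov_product x0 (orb a) (orb b)" and z: "z \<in> V" "dist (\<alpha> s) z \<le> \<kappa>"
    have carr: "a \<in> carrier G" "b \<in> carrier G"
      using a b subgroup.mem_carrier[OF Q(1)] subgroup.mem_carrier[OF R(1)] by auto
    have sa: "s \<in> {0..dist x0 (orb a)}" and sb: "s \<in> {0..dist x0 (orb b)}"
      using s gromov_product_le_left[of x0 "orb a" "orb b"] gromov_product_le_right[of x0 "orb a" "orb b"] by auto
    have ab: "dist (\<alpha> s) (\<beta> s) \<le> \<kappa>0" unfolding \<kappa>0_def by (rule fellow_travel[OF a(2) b(2) s])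
    have "0 \<le> \<kappa>0" using \<delta>_nonneg by (simp add: \<kappa>0_def)
    then have "dist (\<alpha> s) z \<le> \<kappa> + \<kappa>0" using z(2) by simp
    then obtain s1 where s1: "s1 \<in> {0..dist x0 (orb a)}" "\<bar>s1 - s\<bar> \<le> L" "\<alpha> s1 \<in> V"
      using L(2)[OF basepoint_V orb_V[OF carr(1)] a(2) sa z(1)] by blast
    have "dist (\<beta> s) z \<le> \<kappa> + \<kappa>0" using z(2) ab dist_triangle[of "\<beta> s" z "\<alpha> s"] by (simp add: dist_commute)
    then obtain s2 where s2: "s2 \<in> {0..dist x0 (orb b)}" "\<bar>s2 - s\<bar> \<le> L" "\<beta> s2 \<in> V"
      using L(2)[OF basepoint_V orb_V[OF carr(2)] b(2) sb z(1)] by blast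
    obtain q where q: "q \<in> Q" "dist (\<alpha> s1) (orb q) \<le> \<mu>" using \<mu>(2)[OF a s1(1,3)] by blast
    obtain r where r: "r \<in> R" "dist (\<beta> s2) (orb r) \<le> \<nu>" using \<nu>(2)[OF b s2(1,3)] by blast
    have da: "dist (orb q) (\<alpha> s) \<le> \<mu> + L"
      using q(2) s1(2) geodesic_path_dist[OF a(2) s1(1) sa] dist_triangle[of "orb q" "\<alpha> s" "\<alpha> s1"]
      by (simp add: dist_commute)
    have db: "dist (\<beta> s) (orb r) \<le> L + \<nu>"
      using r(2) s2(2) geodesic_path_dist[OF b(2) s2(1) sb] dist_triangle[of "\<beta> s" "orb r" "\<beta> s2"]
      by (simp add: dist_commute)
    have "dist (orb q) (orb r) \<le> \<mu> + L + \<kappa>0 + L + \<nu>"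
      using da db ab dist_triangle[of "orb q" "orb r" "\<alpha> s"] dist_triangle[of "\<alpha> s" "orb r" "\<beta> s"] by simp
    then obtain c where c: "c \<in> Q \<inter> R" "dist (orb q) (orb c) \<le> \<kappa>'" using \<kappa>'[OF q(1) r(1)] by blast
    have "dist (orb c) (\<alpha> s) \<le> \<kappa>' + \<mu> + L"
      using c(2) da dist_triangle[of "orb c" "\<alpha> s" "orb q"] by (simp add: dist_commute)
    then show "\<exists>c\<in>Q \<inter> R. dist (orb c) (\<alpha> s) \<le> \<kappa>' + \<mu> + L" using c by blast
  qed
qed

text \<open>Let the geodesics to \<open>orb a\<close> and \<open>orb b\<close> fellow-travel up to time \<open>t\<close>.  If they are near \<open>V\<close> at
  that time, then there is a point of the orbit of \<open>Q \<inter> R\<close> nearby.  Otherwise they are both deep in a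
  horoball \<open>H\<close>, and by compatibility there is such a point near the place where one of them
  leaves \<open>H\<close>.  In both cases, the path through this point saves about \<open>2 * t\<close>.\<close>

lemma gromov_product_bounded:
  assumes Q: "subgroup Q G" "relatively_quasiconvex \<phi> \<H> x0 Q"
    and R: "subgroup R G" "relatively_quasiconvex \<phi> \<H> x0 R"
    and compat: "compatible_parabolics G \<phi> \<H> Q R"
  obtains M where
    "\<And>a b. \<lbrakk>a \<in> Q; b \<in> R; \<forall>c\<in>Q \<inter> R.
        dist x0 (orb a) + dist x0 (orb b) - 1 \<le> dist (orb c) (orb a) + dist (orb c) (orb b)\<rbrakk>
     \<Longrightarrow> gromov_product x0 (orb a) (orb b) \<le> M"
proof -
  define C where "C = 3 * slim_constant + 2"
  have C: "0 \<le> C" using \<delta>_nonneg by (simp add: C_def)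
  obtain L where L: "0 \<le> L" "\<And>H x y c u v m. \<lbrakk>H \<in> \<H>; geodesic_path x y c; 0 \<le> u; v \<le> dist x y;
      c ` {u<..<v} \<subseteq> H; u + L < m; m < v - L\<rbrakk> \<Longrightarrow> ball (c m) 1 \<subseteq> H"
    by (rule crossing_deep, rule that)
  obtain K0 where K0: "\<And>a b \<alpha> \<beta> s z. \<lbrakk>a \<in> Q; b \<in> R; geodesic_path x0 (orb a) \<alpha>; geodesic_path x0 (orb b) \<beta>;
       0 \<le> s; s \<le> gromov_product x0 (orb a) (orb b); z \<in> V; dist (\<alpha> s) z \<le> 0\<rbrakk>
     \<Longrightarrow> \<exists>c\<in>Q \<inter> R. dist (orb c) (\<alpha> s) \<le> K0"
    by (rule near_intersection[OF Q R], rule that)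
  define K where "K = K0 + L + 1"
  obtain LQ NQ where NQ: "0 \<le> LQ"
    "\<And>a \<alpha> u v H c. \<lbrakk>a \<in> Q; geodesic_path x0 (orb a) \<alpha>; 0 \<le> u; u + LQ < v; v \<le> dist x0 (orb a); \<alpha> v \<in> V;
       \<alpha> ` {u<..<v} \<subseteq> H; H \<in> \<H>; c \<in> Q; near_deep K H (orb c)\<rbrakk>
     \<Longrightarrow> \<exists>p\<in>Q. \<phi> p ` H = H \<and> dist (orb (p \<otimes> c)) (\<alpha> v) \<le> NQ"
    by (rule parabolic_exit[OF Q, of K], rule that)
  obtain LR NR where NR: "0 \<le> LR"
    "\<And>a \<alpha> u v H c. \<lbrakk>a \<in> R; geodesic_path x0 (orb a) \<alpha>; 0 \<le> u; u + LR < v; v \<le> dist x0 (orb a); \<alpha> v \<in> V;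
       \<alpha> ` {u<..<v} \<subseteq> H; H \<in> \<H>; c \<in> R; near_deep K H (orb c)\<rbrakk>
     \<Longrightarrow> \<exists>p\<in>R. \<phi> p ` H = H \<and> dist (orb (p \<otimes> c)) (\<alpha> v) \<le> NR"
    by (rule parabolic_exit[OF R, of K], rule that)
  \<comment> \<open>\<open>4 * C\<close> bounds the distance to the other geodesic,
    \<open>2 * L + 1\<close> leaves room for a deep point after the entrance, and \<open>LQ\<close>,
    \<open>LR\<close> are the crossing lengths that \<open>parabolic_exit\<close> asks for.\<close>
  define \<kappa> where "\<kappa> = 4 * C + 1 + 2 * L + LQ + LR"
  obtain K1 where K1: "\<And>a b \<alpha> \<beta> s z. \<lbrakk>a \<in> Q; b \<in> R; geodesic_path x0 (orb a) \<alpha>; geodesic_path x0 (orb b) \<beta>;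
       0 \<le> s; s \<le> gromov_product x0 (orb a) (orb b); z \<in> V; dist (\<alpha> s) z \<le> \<kappa>\<rbrakk>
     \<Longrightarrow> \<exists>c\<in>Q \<inter> R. dist (orb c) (\<alpha> s) \<le> K1"
    by (rule near_intersection[OF Q R], rule that)
  define M where "M = max K1 (max NQ NR) + C + 1"
  show ?thesis
  proof (rule that[of M])
    fix a b
    assume a: "a \<in> Q" and b: "b \<in> R"
      and min: "\<forall>c\<in>Q \<inter> R.
        dist x0 (orb a) + dist x0 (orb b) - 1 \<le> dist (orb c) (orb a) + dist (orb c) (orb b)"
    define t where "t = gromov_product x0 (orb a) (orb b)"
    have carr: "a \<in> carrier G" "b \<in> carrier G"
      using a b subgroup.mem_carrier[OF Q(1)] subgroup.mem_carrier[OF R(1)] by auto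
    obtain \<alpha> where \<alpha>: "geodesic_path x0 (orb a) \<alpha>" by (rule geodesic_path_exists)
    obtain \<beta> where \<beta>: "geodesic_path x0 (orb b) \<beta>" by (rule geodesic_path_exists)
    have t: "0 \<le> t" "t \<le> dist x0 (orb a)" "t \<le> dist x0 (orb b)"
      unfolding t_def by (rule gromov_product_nonneg gromov_product_le_left gromov_product_le_right)+
    \<comment> \<open>By \<open>min\<close>, passing through \<open>orb c\<close> saves at most 1,
      but by \<open>detour_length\<close> it saves at least \<open>2 * t - 2 * N - 2 * C\<close>;
      this is where \<open>M\<close> comes from.\<close>
    have shortcut: "t \<le> M" if c: "c \<in> Q \<inter> R"
      and \<tau>: "t \<le> \<tau>" "\<tau> \<le> dist x0 (orb a) \<and> dist (orb c) (\<alpha> \<tau>) \<le> N \<or> \<tau> \<le> dist x0 (orb b) \<and> dist (orb c) (\<beta> \<tau>) \<le> N"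
      and N: "N \<le> max K1 (max NQ NR)" for c \<tau> N
      using \<tau>(2)
    proof
      assume "\<tau> \<le> dist x0 (orb a) \<and> dist (orb c) (\<alpha> \<tau>) \<le> N"
      then have "dist (orb c) (orb a) + dist (orb c) (orb b) \<le> dist x0 (orb a) + dist x0 (orb b) - 2 * t + 2 * N + 2 * C"
        using detour_length[OF \<alpha>, of \<tau> "orb c" N "orb b"] t(1) \<tau>(1) by (simp add: t_def[symmetric] C_def)
      then show ?thesis using bspec[OF min c] N by (simp add: M_def)
    next
      assume "\<tau> \<le> dist x0 (orb b) \<and> dist (orb c) (\<beta> \<tau>) \<le> N"
      then have "dist (orb c) (orb b) + dist (orb c) (orb a) \<le> dist x0 (orb b) + dist x0 (orb a) - 2 * t + 2 * N + 2 * C"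
        using detour_length[OF \<beta>, of \<tau> "orb c" N "orb a"] t(1) \<tau>(1)
        by (simp add: gromov_product_commute[of x0 "orb b"] t_def[symmetric] C_def)
      then show ?thesis using bspec[OF min c] N by (simp add: M_def)
    qed
    have "t \<le> M"
    proof (cases "\<exists>z\<in>V. dist (\<alpha> t) z \<le> \<kappa>")
      case True
      then obtain z where z: "z \<in> V" "dist (\<alpha> t) z \<le> \<kappa>" by (rule bexE)
      obtain c where "c \<in> Q \<inter> R" "dist (orb c) (\<alpha> t) \<le> K1"
        using K1[OF a b \<alpha> \<beta> t(1) _ z] by (auto simp: t_def)
      then show ?thesis using shortcut[of c t K1] t by simp
    next
      case False
      then have far: "\<kappa> < dist (\<alpha> t) z" if "z \<in> V" for z using that by (meson not_le)
      have \<kappa>: "0 \<le> \<kappa>" using C L(1) NQ(1) NR(1) by (simp add: \<kappa>_def)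
      have "\<alpha> t \<notin> V" using far[of "\<alpha> t"] \<kappa> by auto
      then obtain H where H: "H \<in> \<H>" "\<alpha> t \<in> H" by blast
      have ab: "dist (\<alpha> t) (\<beta> t) \<le> 4 * C" unfolding C_def
        by (rule fellow_travel[OF \<alpha> \<beta> t(1)]) (simp add: t_def)
      have "ball (\<alpha> t) \<kappa> \<subseteq> H" by (rule ball_in_horoball[OF H]) (use far in fastforce)
      moreover have "4 * C < \<kappa>" using C L(1) NQ(1) NR(1) by (simp add: \<kappa>_def)
      ultimately have \<beta>H: "\<beta> t \<in> H" using ab by auto
      have ends: "\<alpha> 0 \<in> V" "\<alpha> (dist x0 (orb a)) \<in> V" "\<beta> 0 \<in> V" "\<beta> (dist x0 (orb b)) \<in> V"
        unfolding geodesic_path_ends[OF \<alpha>] geodesic_path_ends[OF \<beta>]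
        by (rule basepoint_V orb_V carr)+
      obtain u v where uv: "0 \<le> u" "u < t" "t < v" "v \<le> dist x0 (orb a)" "\<alpha> u \<in> V" "\<alpha> v \<in> V"
          "\<alpha> ` {u<..<v} \<subseteq> H"
        by (rule horoball_crossing[OF geodesic_path_continuous[OF \<alpha>] ends(1,2) t(1,2) H], rule that)
      obtain u' v' where uv': "0 \<le> u'" "u' < t" "t < v'" "v' \<le> dist x0 (orb b)" "\<beta> u' \<in> V" "\<beta> v' \<in> V"
          "\<beta> ` {u'<..<v'} \<subseteq> H"
        by (rule horoball_crossing[OF geodesic_path_continuous[OF \<beta>] ends(3,4) t(1,3) H(1) \<beta>H], rule that)
      have vt: "\<kappa> < v - t" using far[OF uv(6)] geodesic_path_dist[OF \<alpha>, of t v] t uv by auto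
      have "dist (\<beta> t) (\<beta> v') = v' - t" using geodesic_path_dist[OF \<beta>, of t v'] t uv' by auto
      then have vt': "\<kappa> - 4 * C < v' - t"
        using far[OF uv'(6)] ab dist_triangle[of "\<alpha> t" "\<beta> v'" "\<beta> t"] by simp
      \<comment> \<open>The entrance is in \<open>V\<close> and comes before \<open>t\<close>, so
        \<open>near_intersection\<close> applies there with radius 0. The same \<open>c\<close>
        serves for the exits of both geodesics.\<close>
      obtain c where c: "c \<in> Q \<inter> R" "dist (orb c) (\<alpha> u) \<le> K0"
        using K0[OF a b \<alpha> \<beta> uv(1) _ uv(5)] uv(2) by (auto simp: t_def)
      have "ball (\<alpha> (u + L + 1)) 1 \<subseteq> H"
        by (rule L(2)[OF H(1) \<alpha> uv(1) uv(4) uv(7)]) (use vt uv L(1) C NQ NR in \<open>auto simp: \<kappa>_def\<close>)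
      moreover have "dist (\<alpha> u) (\<alpha> (u + L + 1)) = L + 1"
        using geodesic_path_dist[OF \<alpha>, of u "u + L + 1"] uv vt L(1) C NQ(1) NR(1) by (auto simp: \<kappa>_def)
      then have "dist (orb c) (\<alpha> (u + L + 1)) \<le> K"
        using c(2) dist_triangle[of "orb c" "\<alpha> (u + L + 1)" "\<alpha> u"] by (simp add: K_def)
      ultimately have deep: "near_deep K H (orb c)" by (auto simp: near_deep_def)
      define P where "P = stabilizer G (\<lambda>g. image (\<phi> g)) H"
      have P: "p \<in> P \<longleftrightarrow> p \<in> carrier G \<and> \<phi> p ` H = H" for p by (auto simp: P_def stabilizer_def)
      have "maximal_parabolic G \<phi> \<H> P" using H(1) by (auto simp: P_def maximal_parabolic_def)
      then have "Q \<inter> P \<subseteq> R \<inter> P \<or> R \<inter> P \<subseteq> Q \<inter> P" using compat by (simp add: compatible_parabolics_def)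
      then show ?thesis
      proof
        assume sub: "Q \<inter> P \<subseteq> R \<inter> P"
        obtain p where p: "p \<in> Q" "\<phi> p ` H = H" "dist (orb (p \<otimes> c)) (\<alpha> v) \<le> NQ"
          using NQ(2)[OF a \<alpha> uv(1) _ uv(4,6,7) H(1) _ deep] c(1) vt uv(2) L(1) C NR(1) by (auto simp: \<kappa>_def)
        have "p \<in> R" using sub p subgroup.mem_carrier[OF Q(1)] P by blast
        then have "p \<otimes> c \<in> Q \<inter> R" using p(1) c(1) subgroup.m_closed[OF Q(1)] subgroup.m_closed[OF R(1)] by auto
        then show ?thesis using shortcut[of "p \<otimes> c" v NQ] p(3) uv by simp
      next
        assume sub: "R \<inter> P \<subseteq> Q \<inter> P"
        obtain p where p: "p \<in> R" "\<phi> p ` H = H" "dist (orb (p \<otimes> c)) (\<beta> v') \<le> NR"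
          using NR(2)[OF b \<beta> uv'(1) _ uv'(4,6,7) H(1) _ deep] c(1) vt' uv'(2) L(1) C NQ(1) by (auto simp: \<kappa>_def)
        have "p \<in> Q" using sub p subgroup.mem_carrier[OF R(1)] P by blast
        then have "p \<otimes> c \<in> Q \<inter> R" using p(1) c(1) subgroup.m_closed[OF Q(1)] subgroup.m_closed[OF R(1)] by auto
        then show ?thesis using shortcut[of "p \<otimes> c" v' NR] p(3) uv' by simp
      qed
    qed
    then show "gromov_product x0 (orb a) (orb b) \<le> M" by (simp add: t_def)
  qed
qed

end

section \<open>Words of minimal length in an amalgamated product\<close>

abbreviation letter :: "'a + 'a \<Rightarrow> 'a" where
  "letter \<equiv> case_sum (\<lambda>x. x) (\<lambda>x. x)"

context group
begin

lemma amalgam_subgroups: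
  assumes A: "subgroup A G" and B: "subgroup B G"
  shows "amalgam (G\<lparr>carrier := A\<rparr>) (G\<lparr>carrier := B\<rparr>) (G\<lparr>carrier := A \<inter> B\<rparr>) (\<lambda>x. x) (\<lambda>x. x)"
  using subgroup.subgroup_is_group[OF A is_group] subgroup.subgroup_is_group[OF B is_group]
  by (simp add: amalgam_def amalgam_axioms_def hom_def)

text \<open>Minimal length leaves no two adjacent letters that merge, so the factors alternate; a
  letter in \<open>A \<inter> B\<close> with a neighbour could be relabelled for the other factor
  and merged. Among the words of this length, one is chosen whose total of \<open>f\<close> is
  within 1 of the infimum, which need not be attained. Sliding \<open>c\<close> changes two letters
  only, so the bound on the total becomes one for the pair. A single letter has no neighbour, hence
  the separate clause about \<open>\<one>\<close>.\<close>

lemma amalgam_short_word: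
  fixes f :: "'a \<Rightarrow> real"
  assumes A: "subgroup A G" and B: "subgroup B G" and f: "\<And>g. 0 \<le> f g"
    and X: "X \<in> carrier (amalgamated_product (G\<lparr>carrier := A\<rparr>) (G\<lparr>carrier := B\<rparr>)
      (G\<lparr>carrier := A \<inter> B\<rparr>) (\<lambda>x. x) (\<lambda>x. x))"
  obtains w where "w \<in> lists (A <+> B)"
    "X = amalgam_rel (G\<lparr>carrier := A\<rparr>) (G\<lparr>carrier := B\<rparr>) (G\<lparr>carrier := A \<inter> B\<rparr>) (\<lambda>x. x) (\<lambda>x. x) `` {w}"
    "\<And>l. w = [l] \<Longrightarrow> letter l \<noteq> \<one>"
    "\<And>u l l' v. w = u @ l # l' # v \<Longrightarrow> \<exists>a\<in>A - B. \<exists>b\<in>B - A.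
       l = Inl a \<and> l' = Inr b \<and> (\<forall>c\<in>A \<inter> B. f a + f b \<le> f (a \<otimes> c) + f (inv c \<otimes> b) + 1) \<or>
       l = Inr b \<and> l' = Inl a \<and> (\<forall>c\<in>A \<inter> B. f b + f a \<le> f (b \<otimes> c) + f (inv c \<otimes> a) + 1)"
proof -
  let ?A = "G\<lparr>carrier := A\<rparr>" and ?B = "G\<lparr>carrier := B\<rparr>" and ?C = "G\<lparr>carrier := A \<inter> B\<rparr>"
  interpret am: amalgam ?A ?B ?C "\<lambda>x. x" "\<lambda>x. x" by (rule amalgam_subgroups[OF A B])
  let ?eq = "amalgam_eq ?A ?B ?C (\<lambda>x. x) (\<lambda>x. x)"
  note closed = subgroup.m_closed[OF A] subgroup.m_inv_closed[OF A]
    subgroup.m_closed[OF B] subgroup.m_inv_closed[OF B]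
  note carr = subgroup.mem_carrier[OF A] subgroup.mem_carrier[OF B]
  have W: "lists (carrier ?A <+> carrier ?B) = lists (A <+> B)" by simp
  obtain w0 where w0: "w0 \<in> lists (A <+> B)" "X = am.E `` {w0}"
    using am.AP_cases[OF X] W by metis
  define S where "S = {w. ?eq w w0}"
  have w0S: "w0 \<in> S" using w0(1) amalgam_eq.refl[of w0 ?A ?B] by (simp add: S_def)
  define n where "n = (LEAST n. \<exists>w\<in>S. length w = n)"
  have nS: "\<exists>w\<in>S. length w = n" unfolding n_def by (rule LeastI_ex) (use w0S in blast)
  have n_le: "n \<le> length w" if "w \<in> S" for w unfolding n_def by (rule Least_le) (use that in blast)
  define F where "F w = (\<Sum>l\<leftarrow>w. f (letter l))" for w
  have F: "0 \<le> F w" for w unfolding F_def by (intro sum_list_nonneg) (auto simp: f)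
  define S0 where "S0 = {w \<in> S. length w = n}"
  have "S0 \<noteq> {}" using nS by (auto simp: S0_def)
  moreover have bdd: "bdd_below (F ` S0)" by (rule bdd_belowI[of _ 0]) (auto simp: F)
  ultimately have "\<exists>w\<in>S0. F w < Inf (F ` S0) + 1"
    using cInf_lessD[of "F ` S0" "Inf (F ` S0) + 1"] by auto
  then obtain w where w: "w \<in> S0" "F w < Inf (F ` S0) + 1" by blast
  have min: "F w \<le> F w' + 1" if "w' \<in> S0" for w'
    using w(2) cInf_lower[OF _ bdd, of "F w'"] that by auto
  have wS: "w \<in> S" "length w = n" using w(1) by (auto simp: S0_def)
  have wW: "w \<in> lists (A <+> B)" using am.amalgam_eq_words[of w w0] wS W by (auto simp: S_def)
  have replace: "u @ q @ v \<in> S" if eq: "w = u @ p @ v" "?eq p q" for u p q v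
  proof -
    have uv: "u \<in> lists (A <+> B)" "v \<in> lists (A <+> B)" using wW eq(1) by simp_all
    have "?eq (u @ p @ v) (u @ q @ v)"
      by (intro amalgam_eq.append amalgam_eq.refl eq(2)) (use uv W in simp_all)
    then have "?eq (u @ q @ v) w0"
      using wS(1) eq(1) by (auto simp: S_def intro: amalgam_eq.trans amalgam_eq.sym)
    then show ?thesis by (simp add: S_def)
  qed
  have no_merge: False if "w = u @ l # l' # v" "?eq [l, l'] [m]" for u l l' v m
    using n_le[OF replace[of u "[l, l']" v "[m]"]] that wS(2) by simp
  have single: "letter l \<noteq> \<one>" if wl: "w = [l]" for l
  proof
    assume one: "letter l = \<one>"
    have "?eq [l] []"
    proof (cases l)
      case (Inl a)
      then show ?thesis using one amalgam_eq.one_left[of ?A ?B] by simp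
    next
      case (Inr b)
      then show ?thesis using one amalgam_eq.one_right[of ?A ?B] by simp
    qed
    then have "[] \<in> S" using replace[of "[]" "[l]" "[]" "[]"] wl by simp
    then show False using n_le[of "[]"] wS(2) wl by simp
  qed
  have slide: "F [l, l'] \<le> F [m, m'] + 1" if "w = u @ l # l' # v" "?eq [l, l'] [m, m']" for u l l' v m m'
    using min[of "u @ [m, m'] @ v"] replace[of u "[l, l']" v "[m, m']"] that wS(2)
    by (simp add: S0_def F_def)
  have mergeL: "\<exists>m. ?eq [Inl a, Inl a'] [m]" if "a \<in> A" "a' \<in> A" for a a'
    using amalgam_eq.mult_left[of a ?A a' ?B ?C "\<lambda>x. x" "\<lambda>x. x"] that by auto
  have mergeR: "\<exists>m. ?eq [Inr a, Inr a'] [m]" if "a \<in> B" "a' \<in> B" for a a'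
    using amalgam_eq.mult_right[of a ?B a' ?A ?C "\<lambda>x. x" "\<lambda>x. x"] that by auto
  have flip: "?eq [Inl c] [Inr c]" if "c \<in> A" "c \<in> B" for c
    using amalgam_eq.amalgamate[of c ?C] that by simp
  have reflx: "?eq [l] [l]" if "l \<in> A <+> B" for l
    by (rule amalgam_eq.refl) (use that in auto)
  have pair: "?eq [l, l'] [m, m']" if "?eq [l] [m]" "?eq [l'] [m']" for l l' m m'
    using amalgam_eq.append[OF that] by simp
  have "\<exists>a\<in>A - B. \<exists>b\<in>B - A.
       l = Inl a \<and> l' = Inr b \<and> (\<forall>c\<in>A \<inter> B. f a + f b \<le> f (a \<otimes> c) + f (inv c \<otimes> b) + 1) \<or>
       l = Inr b \<and> l' = Inl a \<and> (\<forall>c\<in>A \<inter> B. f b + f a \<le> f (b \<otimes> c) + f (inv c \<otimes> a) + 1)"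
    if wl: "w = u @ l # l' # v" for u l l' v
  proof -
    have ll: "l \<in> A <+> B" "l' \<in> A <+> B" using wW wl by simp_all
    have nm: False if "?eq [l, l'] [m, m']" "\<exists>k. ?eq [m, m'] [k]" for m m'
      using no_merge[OF wl] amalgam_eq.trans[OF that(1)] that(2) by blast
    consider (LL) a a' where "l = Inl a" "l' = Inl a'" "a \<in> A" "a' \<in> A"
      | (RR) b b' where "l = Inr b" "l' = Inr b'" "b \<in> B" "b' \<in> B"
      | (LR) a b where "l = Inl a" "l' = Inr b" "a \<in> A" "b \<in> B"
      | (RL) a b where "l = Inr b" "l' = Inl a" "a \<in> A" "b \<in> B"
      using ll by (auto elim!: PlusE)
    then show ?thesis
    proof cases
      case LL
      then show ?thesis using nm[OF pair[OF reflx reflx]] mergeL ll by blast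
    next
      case RR
      then show ?thesis using nm[OF pair[OF reflx reflx]] mergeR ll by blast
    next
      case LR
      have "a \<notin> B"
        using nm[of "Inr a" "Inr b"] pair[OF flip reflx[OF ll(2)]] mergeR LR by blast
      moreover have "b \<notin> A"
        using nm[of "Inl a" "Inl b"] pair[OF reflx[OF ll(1)] amalgam_eq.sym[OF flip]] mergeL LR by blast
      moreover have "f a + f b \<le> f (a \<otimes> c) + f (inv c \<otimes> b) + 1" if c: "c \<in> A \<inter> B" for c
      proof -
        have cc: "c \<in> A" "c \<in> B" "inv c \<in> A" "inv c \<in> B" using c closed by auto
        have mem: "a \<otimes> c \<in> A" "inv c \<otimes> b \<in> B" using closed cc LR by auto
        have cb: "c \<otimes> (inv c \<otimes> b) = b" using carr cc LR by (simp add: m_assoc[symmetric])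
        have "?eq [Inl a, Inl c] [Inl (a \<otimes> c)]" using amalgam_eq.mult_left[of a ?A c] cc LR by simp
        moreover have "?eq [Inl a, Inl c] [Inl a, Inr c]"
          by (rule pair[OF reflx flip]) (use cc LR in auto)
        ultimately have "?eq [Inl a, Inr c] [Inl (a \<otimes> c)]"
          using amalgam_eq.trans amalgam_eq.sym by blast
        \<comment> \<open>The word \<open>[Inl a, Inr c, Inr (inv c \<otimes> b)]\<close> is
          shortened in two ways, by merging its first two or its last two letters.\<close>
        then have "?eq ([Inl a, Inr c] @ [Inr (inv c \<otimes> b)]) ([Inl (a \<otimes> c)] @ [Inr (inv c \<otimes> b)])"
          by (intro amalgam_eq.append reflx) (use mem in auto)
        moreover have "?eq [Inr c, Inr (inv c \<otimes> b)] [Inr b]"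
          using amalgam_eq.mult_right[of c ?B "inv c \<otimes> b"] cc mem cb by simp
        then have "?eq ([Inl a] @ [Inr c, Inr (inv c \<otimes> b)]) ([Inl a] @ [Inr b])"
          by (intro amalgam_eq.append reflx) (use LR in auto)
        ultimately have "?eq [Inl a, Inr b] [Inl (a \<otimes> c), Inr (inv c \<otimes> b)]"
          using amalgam_eq.trans amalgam_eq.sym by fastforce
        then show ?thesis using slide[OF wl, of "Inl (a \<otimes> c)" "Inr (inv c \<otimes> b)"] LR by (simp add: F_def)
      qed
      ultimately show ?thesis using LR by auto
    next
      case RL
      have "b \<notin> A"
        using nm[of "Inl b" "Inl a"] pair[OF amalgam_eq.sym[OF flip] reflx[OF ll(2)]] mergeL RL by blast
      moreover have "a \<notin> B"
        using nm[of "Inr b" "Inr a"] pair[OF reflx[OF ll(1)] flip] mergeR RL by blast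
      moreover have "f b + f a \<le> f (b \<otimes> c) + f (inv c \<otimes> a) + 1" if c: "c \<in> A \<inter> B" for c
      proof -
        have cc: "c \<in> A" "c \<in> B" "inv c \<in> A" "inv c \<in> B" using c closed by auto
        have mem: "b \<otimes> c \<in> B" "inv c \<otimes> a \<in> A" using closed cc RL by auto
        have ca: "c \<otimes> (inv c \<otimes> a) = a" using carr cc RL by (simp add: m_assoc[symmetric])
        have "?eq [Inr b, Inr c] [Inr (b \<otimes> c)]" using amalgam_eq.mult_right[of b ?B c] cc RL by simp
        moreover have "?eq [Inr b, Inr c] [Inr b, Inl c]"
          by (rule pair[OF reflx amalgam_eq.sym[OF flip]]) (use cc RL in auto)
        ultimately have "?eq [Inr b, Inl c] [Inr (b \<otimes> c)]"
          using amalgam_eq.trans amalgam_eq.sym by blast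
        then have "?eq ([Inr b, Inl c] @ [Inl (inv c \<otimes> a)]) ([Inr (b \<otimes> c)] @ [Inl (inv c \<otimes> a)])"
          by (intro amalgam_eq.append reflx) (use mem in auto)
        moreover have "?eq [Inl c, Inl (inv c \<otimes> a)] [Inl a]"
          using amalgam_eq.mult_left[of c ?A "inv c \<otimes> a"] cc mem ca by simp
        then have "?eq ([Inr b] @ [Inl c, Inl (inv c \<otimes> a)]) ([Inr b] @ [Inl a])"
          by (intro amalgam_eq.append reflx) (use RL in auto)
        ultimately have "?eq [Inr b, Inl a] [Inr (b \<otimes> c), Inl (inv c \<otimes> a)]"
          using amalgam_eq.trans amalgam_eq.sym by fastforce
        then show ?thesis using slide[OF wl, of "Inr (b \<otimes> c)" "Inl (inv c \<otimes> a)"] RL by (simp add: F_def)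
      qed
      ultimately show ?thesis using RL by auto
    qed
  qed
  moreover have "X = am.E `` {w}"
    using am.class_eqI[of w w0] wS(1) w0(2) by (simp add: S_def)
  ultimately show ?thesis using that[OF wW] single by blast
qed

end

section \<open>Broken geodesics and injectivity\<close>

context relatively_hyperbolic
begin

text \<open>As the pieces are long, replacing the next vertex of the path by its endpoint changes the Gromov
  product at the current vertex only by a constant, which does not accumulate.\<close>

lemma broken_geodesic:
  assumes "w \<noteq> []" and "letter ` set w \<subseteq> carrier G"
    and "\<And>l. l \<in> set w \<Longrightarrow> 2 * (M + (3 * slim_constant + 2)) < dist x0 (orb (letter l))"
    and "successively (\<lambda>l l'. gromov_product x0 (orb (inv (letter l))) (orb (letter l')) \<le> M) w"
    and M: "0 \<le> M"
  shows "gromov_product x0 (orb (inv (letter (hd w)))) (orb (word_value G (\<lambda>x. x) (\<lambda>x. x) (tl w)))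
        \<le> M + (3 * slim_constant + 2) \<and>
      0 < dist x0 (orb (word_value G (\<lambda>x. x) (\<lambda>x. x) w))"
  using assms(1-4)
proof (induction w)
  case (Cons l w)
  define C where "C = 3 * slim_constant + 2"
  have C: "0 \<le> C" using \<delta>_nonneg by (simp add: C_def)
  define g where "g = letter l"
  define W where "W = word_value G (\<lambda>x. x) (\<lambda>x. x) w"
  have lW: "word_value G (\<lambda>x. x) (\<lambda>x. x) (l # w) = g \<otimes> W" by (simp add: word_value_def W_def g_def)
  have g: "g \<in> carrier G" "2 * (M + C) < dist x0 (orb g)"
    using Cons.prems(2) Cons.prems(3)[of l] by (simp_all add: g_def C_def)
  have Wcarr: "word_value G (\<lambda>x. x) (\<lambda>x. x) v \<in> carrier G" if "letter ` set v \<subseteq> carrier G" for v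
    using that by (induction v) (auto simp: word_value_def)
  have W: "W \<in> carrier G" unfolding W_def by (rule Wcarr) (use Cons.prems(2) in auto)
  have gp: "gromov_product x0 (orb (inv g)) (orb W) \<le> M + C"
  proof (cases w)
    case Nil
    then have "orb W = x0" by (simp add: W_def word_value_def act_one)
    then show ?thesis using M C by (simp add: gromov_product_def dist_commute)
  next
    case (Cons l' v)
    define h where "h = letter l'"
    define W' where "W' = word_value G (\<lambda>x. x) (\<lambda>x. x) v"
    have h: "h \<in> carrier G" "2 * (M + C) < dist x0 (orb h)"
      using Cons.prems(2) Cons.prems(3)[of l'] Cons by (simp_all add: h_def C_def)
    have W': "W' \<in> carrier G" unfolding W'_def by (rule Wcarr) (use Cons.prems(2) Cons in auto)
    have hW: "W = h \<otimes> W'" by (simp add: word_value_def W_def W'_def h_def Cons)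
    \<comment> \<open>The induction hypothesis bounds the product at the next vertex. As
      \<open>h\<close> is long, the product of \<open>orb W\<close> and \<open>orb h\<close> at the
      current vertex then exceeds \<open>M + C\<close>, so the minimum in the four-point inequality
      is the product of \<open>orb (inv g)\<close> and \<open>orb W\<close>.\<close>
    have "gromov_product x0 (orb (inv h)) (orb W') \<le> M + C"
      using Cons.IH Cons.prems Cons by (simp add: C_def h_def W'_def successively_Cons)
    then have "gromov_product (orb h) x0 (orb W) \<le> M + C"
      using gromov_product_isometry[OF isometric[OF h(1)], of x0 "orb (inv h)" "orb W'"] h W'
      by (simp add: hW act_mult act_inv)
    then have "M + C < gromov_product x0 (orb W) (orb h)"
      using gromov_product_shift[of x0 "orb h" "orb W"] h(2) by (simp add: gromov_product_commute[of x0])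
    moreover have "gromov_product x0 (orb (inv g)) (orb h) \<le> M"
      using Cons.prems(4) Cons by (simp add: g_def h_def)
    ultimately show ?thesis
      using four_point[of x0 "orb (inv g)" "orb W" "orb h"] by (simp add: C_def min_def split: if_splits)
  qed
  have "dist (orb (inv g)) (orb W) = dist x0 (orb (g \<otimes> W))"
    using g W by (simp add: dist_orb)
  moreover have "dist x0 (orb (inv g)) = dist x0 (orb g)" by (rule dist_orb_inv[OF g(1)])
  ultimately have "dist x0 (orb g) + dist x0 (orb W) - dist x0 (orb (g \<otimes> W)) \<le> 2 * (M + C)"
    using gp by (simp add: gromov_product_def)
  then have "0 < dist x0 (orb (g \<otimes> W))"
    using g(2) zero_le_dist[of x0 "orb W"] by linarith
  then show ?case using gp by (simp add: lW g_def W_def C_def del: zero_less_dist_iff)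
qed simp

text \<open>It suffices that the kernel is trivial. With displacement as the weight, sliding
  \<open>d\<close> between two letters amounts to a detour through \<open>orb d\<close>, so
  \<open>gromov_product_bounded\<close> applies at each junction of a short word. With at least two
  letters, all of them lie outside \<open>Q \<inter> R\<close> and are long, and
  \<open>broken_geodesic\<close> shows that the value moves \<open>x0\<close>.\<close>

lemma amalgam_map_injective:
  assumes Q: "subgroup Q G" "relatively_quasiconvex \<phi> \<H> x0 Q"
    and R: "subgroup R G" "relatively_quasiconvex \<phi> \<H> x0 R"
    and compat: "compatible_parabolics G \<phi> \<H> Q R"
  obtains T where
    "\<And>A B. \<lbrakk>subgroup A G; subgroup B G; A \<subseteq> Q; B \<subseteq> R; A \<inter> B = Q \<inter> R;
        \<forall>g\<in>A \<union> B - Q \<inter> R. T < dist x0 (orb g)\<rbrakk>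
     \<Longrightarrow> inj_on (amalgam_map G (\<lambda>x. x) (\<lambda>x. x))
           (carrier (amalgamated_product (G\<lparr>carrier := A\<rparr>) (G\<lparr>carrier := B\<rparr>)
              (G\<lparr>carrier := A \<inter> B\<rparr>) (\<lambda>x. x) (\<lambda>x. x)))"
proof -
  obtain M0 where M0: "\<And>a b. \<lbrakk>a \<in> Q; b \<in> R; \<forall>c\<in>Q \<inter> R.
        dist x0 (orb a) + dist x0 (orb b) - 1 \<le> dist (orb c) (orb a) + dist (orb c) (orb b)\<rbrakk>
     \<Longrightarrow> gromov_product x0 (orb a) (orb b) \<le> M0"
    by (rule gromov_product_bounded[OF Q R compat], rule that)
  define M where "M = max 0 M0"
  show ?thesis
  proof (rule that[of "2 * (M + (3 * slim_constant + 2))"])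
    fix A B
    assume A: "subgroup A G" and B: "subgroup B G" and AQ: "A \<subseteq> Q" and BR: "B \<subseteq> R"
      and AB: "A \<inter> B = Q \<inter> R"
      and long: "\<forall>g\<in>A \<union> B - Q \<inter> R. 2 * (M + (3 * slim_constant + 2)) < dist x0 (orb g)"
    let ?A = "G\<lparr>carrier := A\<rparr>" and ?B = "G\<lparr>carrier := B\<rparr>" and ?C = "G\<lparr>carrier := A \<inter> B\<rparr>"
    let ?AP = "amalgamated_product ?A ?B ?C (\<lambda>x. x) (\<lambda>x. x)"
    let ?h = "amalgam_map G (\<lambda>x. x) (\<lambda>x. x)"
    let ?val = "word_value G (\<lambda>x. x) (\<lambda>x. x)"
    interpret am: amalgam ?A ?B ?C "\<lambda>x. x" "\<lambda>x. x" by (rule amalgam_subgroups[OF A B])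
    note carr = subgroup.mem_carrier[OF A] subgroup.mem_carrier[OF B]
    have homs: "(\<lambda>x. x) \<in> hom ?A G" "(\<lambda>x. x) \<in> hom ?B G" using carr by (auto simp: hom_def)
    have "X = \<one>\<^bsub>?AP\<^esub>" if X: "X \<in> carrier ?AP" "?h X = \<one>" for X
    proof -
      obtain w where w: "w \<in> lists (A <+> B)" "X = am.E `` {w}"
        "\<And>l. w = [l] \<Longrightarrow> letter l \<noteq> \<one>"
        "\<And>u l l' v. w = u @ l # l' # v \<Longrightarrow> \<exists>a\<in>A - B. \<exists>b\<in>B - A.
       l = Inl a \<and> l' = Inr b \<and> (\<forall>c\<in>A \<inter> B. dist x0 (orb a) + dist x0 (orb b)
          \<le> dist x0 (orb (a \<otimes> c)) + dist x0 (orb (inv c \<otimes> b)) + 1) \<or>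
       l = Inr b \<and> l' = Inl a \<and> (\<forall>c\<in>A \<inter> B. dist x0 (orb b) + dist x0 (orb a)
          \<le> dist x0 (orb (b \<otimes> c)) + dist x0 (orb (inv c \<otimes> a)) + 1)"
        by (rule amalgam_short_word[OF A B _ X(1), of "\<lambda>g. dist x0 (orb g)"], simp, rule that)
      have val: "?val w = \<one>"
        using am.amalgam_map_class[OF is_group homs, of w] X(2) w(1,2) by simp
      have lc: "letter ` set w \<subseteq> carrier G" using w(1) carr by (force elim!: PlusE)
      have "w = []"
      proof (rule ccontr)
        assume wne: "w \<noteq> []"
        show False
        proof (cases "\<exists>l. w = [l]")
          \<comment> \<open>A single letter may lie in \<open>Q \<inter> R\<close> and be short, so
            it is excluded by its value alone.\<close>
          case True
          then obtain l where l: "w = [l]" by blast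
          then have "letter l \<in> carrier G" using lc by auto
          then have "letter l = \<one>" using val l by (simp add: word_value_def)
          then show False using w(3)[OF l] by simp
        next
          case False
          have pairs: "w = take i w @ w ! i # w ! Suc i # drop (Suc (Suc i)) w" if "Suc i < length w" for i
            using that by (metis Cons_nth_drop_Suc Suc_lessD append_take_drop_id)
          have len: "2 \<le> length w" using wne False by (cases w; cases "tl w") auto
          have "2 * (M + (3 * slim_constant + 2)) < dist x0 (orb (letter l))" if l: "l \<in> set w" for l
          proof -
            obtain i where i: "i < length w" "l = w ! i" using l by (auto simp: in_set_conv_nth)
            \<comment> \<open>Every letter belongs to an adjacent pair; the last one is the second
              member of its pair.\<close>
            have "letter l \<in> A \<union> B - A \<inter> B"
            proof (cases "Suc i < length w")
              case True
              show ?thesis using w(4)[OF pairs[OF True]] i(2) by auto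
            next
              case False
              then obtain j where j: "i = Suc j" using len i by (cases i) auto
              then have Sj: "Suc j < length w" using i by simp
              show ?thesis using w(4)[OF pairs[OF Sj]] i(2) j by auto
            qed
            then show ?thesis using long AB by simp
          qed
          moreover have "successively (\<lambda>l l'. gromov_product x0 (orb (inv (letter l))) (orb (letter l')) \<le> M) w"
            unfolding successively_conv_nth
          proof (intro allI impI)
            fix i assume i: "Suc i < length w"
            show "gromov_product x0 (orb (inv (letter (w ! i)))) (orb (letter (w ! Suc i))) \<le> M"
              using w(4)[OF pairs[OF i]]
            proof (elim bexE disjE conjE)
              fix a b assume ab: "a \<in> A - B" "b \<in> B - A" "w ! i = Inl a" "w ! Suc i = Inr b"
                and min: "\<forall>c\<in>A \<inter> B. dist x0 (orb a) + dist x0 (orb b)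
                   \<le> dist x0 (orb (a \<otimes> c)) + dist x0 (orb (inv c \<otimes> b)) + 1"
              have c: "a \<in> carrier G" "b \<in> carrier G" using carr ab by auto
              have "gromov_product x0 (orb (inv a)) (orb b) \<le> M0"
              proof (intro M0 ballI)
                show "inv a \<in> Q" "b \<in> R" using ab AQ BR subgroup.m_inv_closed[OF Q(1)] by auto
                fix d assume "d \<in> Q \<inter> R"
                then have d: "d \<in> A \<inter> B" "d \<in> carrier G" using AB carr by auto
                have "dist (orb d) (orb (inv a)) = dist x0 (orb (a \<otimes> d))"
                  using c d by (simp add: dist_commute[of "orb d"] dist_orb)
                moreover have "dist (orb d) (orb b) = dist x0 (orb (inv d \<otimes> b))"
                  using c d by (simp add: dist_orb)
                ultimately show "dist x0 (orb (inv a)) + dist x0 (orb b) - 1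
                    \<le> dist (orb d) (orb (inv a)) + dist (orb d) (orb b)"
                  using bspec[OF min d(1)] dist_orb_inv[OF c(1)] by linarith
              qed
              then show ?thesis using ab by (simp add: M_def)
            next
              fix a b assume ab: "a \<in> A - B" "b \<in> B - A" "w ! i = Inr b" "w ! Suc i = Inl a"
                and min: "\<forall>c\<in>A \<inter> B. dist x0 (orb b) + dist x0 (orb a)
                   \<le> dist x0 (orb (b \<otimes> c)) + dist x0 (orb (inv c \<otimes> a)) + 1"
              have c: "a \<in> carrier G" "b \<in> carrier G" using carr ab by auto
              have "gromov_product x0 (orb a) (orb (inv b)) \<le> M0"
              proof (intro M0 ballI)
                show "a \<in> Q" "inv b \<in> R" using ab AQ BR subgroup.m_inv_closed[OF R(1)] by auto
                fix d assume "d \<in> Q \<inter> R"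
                then have d: "d \<in> A \<inter> B" "d \<in> carrier G" using AB carr by auto
                have "dist (orb d) (orb (inv b)) = dist x0 (orb (b \<otimes> d))"
                  using c d by (simp add: dist_commute[of "orb d"] dist_orb)
                moreover have "dist (orb d) (orb a) = dist x0 (orb (inv d \<otimes> a))"
                  using c d by (simp add: dist_orb)
                ultimately show "dist x0 (orb a) + dist x0 (orb (inv b)) - 1
                    \<le> dist (orb d) (orb a) + dist (orb d) (orb (inv b))"
                  using bspec[OF min d(1)] dist_orb_inv[OF c(2)] by linarith
              qed
              then show ?thesis using ab by (simp add: M_def gromov_product_commute[of x0 "orb a"])
            qed
          qed
          ultimately have "0 < dist x0 (orb (?val w))"
            using broken_geodesic[OF wne lc, of M] by (simp add: M_def)
          then show False by (simp add: val act_one)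
        qed
      qed
      then show ?thesis using w(2) am.one_AP by simp
    qed
    then show "inj_on ?h (carrier ?AP)"
      using inj_on_one_iff'[OF am.amalgam_map_hom[OF is_group homs] am.group_AP is_group] by simp
  qed
qed

end

section \<open>Finite index subgroups\<close>

context group
begin

text \<open>Send \<open>q\<close> in \<open>Q\<close> to the family of cosets \<open>K #> q\<close>
  for \<open>K\<close> in \<open>F\<close>. This family takes finitely many values and determines
  the coset of \<open>q\<close>.\<close>

lemma finite_index_Int_restrict:
  assumes Q: "subgroup Q G" and F: "finite F" and K: "\<And>K. K \<in> F \<Longrightarrow> finite_index_subgroup K G"
  shows "finite_index_subgroup {q \<in> Q. \<forall>K\<in>F. q \<in> K} (G\<lparr>carrier := Q\<rparr>)"
proof -
  let ?Q' = "{q \<in> Q. \<forall>K\<in>F. q \<in> K}" and ?G = "G\<lparr>carrier := Q\<rparr>"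
  have Ks: "subgroup K G" "finite (rcosets K)" if "K \<in> F" for K
    using K[OF that] by (auto simp: finite_index_subgroup_def)
  have sub: "subgroup ?Q' G"
  proof (rule subgroupI)
    show "?Q' \<subseteq> carrier G" using subgroup.subset[OF Q] by blast
    have "\<one> \<in> ?Q'" using subgroup.one_closed[OF Q] subgroup.one_closed[OF Ks(1)] by simp
    then show "?Q' \<noteq> {}" by blast
    fix a assume a: "a \<in> ?Q'"
    then show "inv a \<in> ?Q'" using subgroup.m_inv_closed[OF Q] subgroup.m_inv_closed[OF Ks(1)] by simp
    fix b assume "b \<in> ?Q'"
    then show "a \<otimes> b \<in> ?Q'" using a subgroup.m_closed[OF Q] subgroup.m_closed[OF Ks(1)] by simp
  qed
  have "subgroup ?Q' ?G" by (rule subgroup_incl[OF sub Q]) blast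
  moreover have "finite (rcosets\<^bsub>?G\<^esub> ?Q')"
  proof -
    define T where "T q = restrict (\<lambda>K. K #> q) F" for q
    have "T ` Q \<subseteq> PiE F (\<lambda>K. rcosets K)"
      using subgroup.mem_carrier[OF Q] subgroup.subset[OF Ks(1)] rcosetsI by (auto simp: T_def)
    then have fin: "finite (T ` Q)" by (rule finite_subset) (intro finite_PiE F Ks(2))
    have eq: "?Q' #>\<^bsub>?G\<^esub> p = ?Q' #>\<^bsub>?G\<^esub> q" if pq: "p \<in> Q" "q \<in> Q" "T p = T q" for p q
    proof -
      have c: "p \<in> carrier G" "q \<in> carrier G" using pq subgroup.mem_carrier[OF Q] by auto
      have "p \<otimes> inv q \<in> K" if "K \<in> F" for K
      proof -
        have "K #> p = K #> q" using fun_cong[OF pq(3), of K] that by (simp add: T_def)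
        then have "p \<in> K #> q" using rcos_self[OF c(1) Ks(1)[OF that]] by simp
        then show ?thesis using subgroup.rcos_module_imp[OF Ks(1)[OF that] is_group c(2)] by blast
      qed
      then have "p \<otimes> inv q \<in> ?Q'" using pq subgroup.m_closed[OF Q] subgroup.m_inv_closed[OF Q] by simp
      then have "p \<in> ?Q' #> q"
        using subgroup.rcos_module_rev[OF sub is_group c(2) c(1)] by blast
      then have "?Q' #> q = ?Q' #> p" by (rule repr_independence[OF _ c(2) sub])
      then show ?thesis by (simp add: r_coset_def)
    qed
    have "rcosets\<^bsub>?G\<^esub> ?Q' = (\<lambda>q. ?Q' #>\<^bsub>?G\<^esub> q) ` Q" by (auto simp: RCOSETS_def)
    also have "\<dots> \<subseteq> (\<lambda>t. ?Q' #>\<^bsub>?G\<^esub> inv_into Q T t) ` T ` Q"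
    proof
      fix X assume "X \<in> (\<lambda>q. ?Q' #>\<^bsub>?G\<^esub> q) ` Q"
      then obtain q where q: "q \<in> Q" "X = ?Q' #>\<^bsub>?G\<^esub> q" by (rule imageE) (rule that)
      have Tq: "T q \<in> T ` Q" using q(1) by (rule imageI)
      have "X = ?Q' #>\<^bsub>?G\<^esub> inv_into Q T (T q)"
        unfolding q(2) by (rule eq[OF q(1) inv_into_into[OF Tq]]) (simp only: f_inv_into_f[OF Tq])
      then show "X \<in> (\<lambda>t. ?Q' #>\<^bsub>?G\<^esub> inv_into Q T t) ` T ` Q" using Tq by (rule image_eqI)
    qed
    finally show ?thesis by (rule finite_subset) (rule finite_imageI[OF fin])
  qed
  ultimately show ?thesis by (simp add: finite_index_subgroup_def)
qed

end

section \<open>Choice of the finite index subgroups\<close>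

theorem corollary4:
  fixes G :: "('a, 'm) monoid_scheme"
    and \<phi> :: "'a \<Rightarrow> 'x::metric_space \<Rightarrow> 'x"
    and \<PP> :: "'a set set" and \<H> :: "'x set set" and x0 :: 'x
    and Q R :: "'a set"
  assumes "relatively_hyperbolic G \<phi> \<PP> \<H> x0"
    and "subgroup Q G" and "relatively_quasiconvex \<phi> \<H> x0 Q"
    and "subgroup R G" and "relatively_quasiconvex \<phi> \<H> x0 R"
    and "compatible_parabolics G \<phi> \<H> Q R"
    and "separable_subgroup (Q \<inter> R) G"
  shows "virtually_amalgamable G Q R"
proof -
  interpret relatively_hyperbolic G \<phi> \<PP> \<H> x0 by fact
  note Q = assms(2) and R = assms(4)
  obtain T where T: "\<And>A B. \<lbrakk>subgroup A G; subgroup B G; A \<subseteq> Q; B \<subseteq> R; A \<inter> B = Q \<inter> R;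
        \<forall>g\<in>A \<union> B - Q \<inter> R. T < dist x0 (orb g)\<rbrakk>
     \<Longrightarrow> inj_on (amalgam_map G (\<lambda>x. x) (\<lambda>x. x))
           (carrier (amalgamated_product (G\<lparr>carrier := A\<rparr>) (G\<lparr>carrier := B\<rparr>)
              (G\<lparr>carrier := A \<inter> B\<rparr>) (\<lambda>x. x) (\<lambda>x. x)))"
    by (rule amalgam_map_injective[OF assms(2-6)], rule that)
  obtain \<F> where F: "\<And>K. K \<in> \<F> \<Longrightarrow> finite_index_subgroup K G" "Q \<inter> R = \<Inter>\<F>"
    using assms(7) by (auto simp: separable_subgroup_def)
  \<comment> \<open>Each of the finitely many short elements outside \<open>Q \<inter> R\<close> is
    excluded by some member of \<open>\<F>\<close>. All members contain \<open>Q \<inter> R\<close>,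
    so cutting \<open>Q\<close> and \<open>R\<close> down by the chosen ones leaves their
    intersection unchanged.\<close>
  define S where "S = {g \<in> carrier G. dist x0 (orb g) \<le> T} - Q \<inter> R"
  have "\<exists>K. K \<in> \<F> \<and> g \<notin> K" if "g \<in> S" for g using that F(2) by (auto simp: S_def)
  then obtain \<kappa> where \<kappa>: "\<And>g. g \<in> S \<Longrightarrow> \<kappa> g \<in> \<F> \<and> g \<notin> \<kappa> g" by metis
  have fin: "finite (\<kappa> ` S)" using finite_short_elements[of T] by (simp add: S_def)
  define Q' where "Q' = {q \<in> Q. \<forall>K\<in>\<kappa> ` S. q \<in> K}"
  define R' where "R' = {r \<in> R. \<forall>K\<in>\<kappa> ` S. r \<in> K}"
  have fi: "finite_index_subgroup Q' (G\<lparr>carrier := Q\<rparr>)" "finite_index_subgroup R' (G\<lparr>carrier := R\<rparr>)"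
    unfolding Q'_def R'_def by (intro finite_index_Int_restrict Q R fin; use \<kappa> F(1) in blast)+
  have "inj_on (amalgam_map G (\<lambda>x. x) (\<lambda>x. x))
           (carrier (amalgamated_product (G\<lparr>carrier := Q'\<rparr>) (G\<lparr>carrier := R'\<rparr>)
              (G\<lparr>carrier := Q' \<inter> R'\<rparr>) (\<lambda>x. x) (\<lambda>x. x)))"
  proof (intro T ballI)
    show "subgroup Q' G" "subgroup R' G"
      using fi incl_subgroup[OF Q] incl_subgroup[OF R] by (auto simp: finite_index_subgroup_def)
    show "Q' \<subseteq> Q" "R' \<subseteq> R" by (auto simp: Q'_def R'_def)
    show "Q' \<inter> R' = Q \<inter> R" using \<kappa> F(2) by (auto simp: Q'_def R'_def)
    fix g assume g: "g \<in> Q' \<union> R' - Q \<inter> R"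
    then have "g \<in> carrier G"
      using subgroup.mem_carrier[OF Q] subgroup.mem_carrier[OF R] by (auto simp: Q'_def R'_def)
    moreover have "g \<notin> S" using \<kappa> g by (auto simp: Q'_def R'_def)
    ultimately show "T < dist x0 (orb g)" using g by (auto simp: S_def)
  qed
  then show ?thesis using fi by (auto simp: virtually_amalgamable_def)
qed

end
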